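(* Let $\Gamma\subset\mathbb{R}^2$ be a lattice, let $M=\mathbb{R}^2/\Gamma$ be the two-torus with complex parameter $z=x+iy$, let $ds^2=g(x,y)(dx^2+dy^2)$ be an arbitrary smooth Riemannian metric on $M$ (so $g$ is a smooth positive $\Gamma$-periodic function), and let $E>0$. Let $k=2q+1$ be an odd positive integer. Consider the system of equations for smooth complex-valued functions $a_{2q+1},a_{2q-1},\dots,a_1$ on $M$: $$\frac{\partial a_{2q+1}}{\partial\bar z}=0,$$ $$\frac{\partial a_{2m-1}}{\partial\bar z}+\frac{E}{2}\left((2m+1)\,a_{2m+1}\frac{\partial g}{\partial z}+g\,\frac{\partial a_{2m+1}}{\partial z}\right)=0,\qquad 1\le m\le q.$$ Then this system is successively solvable for $a_k=\mathrm{const}$, $a_{k-2}$, $a_{k-4}$ and $a_{k-6}$ (those of them whose index is at least $1$). That is: the solutions of the first equation are the constants; and for every nonzero constant $a_k$, the equation for $a_{k-2}$ has a smooth solution on $M$; for every such solution $a_{k-2}$, the equation for $a_{k-4}$ has a smooth solution on $M$; and for every such $a_{k-2},a_{k-4}$, the equation for $a_{k-6}$ has a smooth solution on $M$. On every step the solution $a_n$ is determined up to an additive constant.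
   Context: Notation: $\frac{\partial}{\partial z}=\frac12\left(\frac{\partial}{\partial x}-i\frac{\partial}{\partial y}\right)$ and $\frac{\partial}{\partial\bar z}=\frac12\left(\frac{\partial}{\partial x}+i\frac{\partial}{\partial y}\right)$. The equation for $a_n$ ($n=2m-1$) is the one containing $\frac{\partial a_n}{\partial\bar z}$ and the already found $a_{n+2}$. "Successively solvable" means that the equations are solved one after another in decreasing order of the index, each having a smooth solution on the torus once the previous functions have been chosen. The number $E$ is a fixed positive value of the energy. *)

theory Defs
  imports "HOL-Analysis.Analysis"
begin

text \<open>The plane is modelled by the type \<^typ>\<open>complex\<close> with its real normed vector space
  structure; independence below is linear independence over the reals.\<close>

definition plane_lattice :: "complex set \<Rightarrow> bool" where
  "plane_lattice \<Gamma> \<longleftrightarrow>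
     (\<exists>\<omega>1 \<omega>2. \<omega>1 \<noteq> \<omega>2 \<and> independent {\<omega>1, \<omega>2} \<and>
        \<Gamma> = {of_int m * \<omega>1 + of_int n * \<omega>2 | (m::int) (n::int). True})"

primrec times_cont_differentiable ::
  "nat \<Rightarrow> ('a::real_normed_vector \<Rightarrow> 'b::real_normed_vector) \<Rightarrow> bool" where
  "times_cont_differentiable 0 f \<longleftrightarrow> continuous_on UNIV f"
| "times_cont_differentiable (Suc n) f \<longleftrightarrow>
     (\<forall>x. f differentiable (at x)) \<and>
     (\<forall>v. times_cont_differentiable n (\<lambda>x. frechet_derivative f (at x) v))"

definition smooth :: "('a::real_normed_vector \<Rightarrow> 'b::real_normed_vector) \<Rightarrow> bool" where
  "smooth f \<longleftrightarrow> (\<forall>n. times_cont_differentiable n f)"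

text \<open>Smooth functions on the torus (the plane modulo \<open>\<Gamma>\<close>) are identified with
  the smooth \<open>\<Gamma>\<close>-periodic functions on the plane.\<close>

definition torus_smooth :: "complex set \<Rightarrow> (complex \<Rightarrow> 'b::real_normed_vector) \<Rightarrow> bool" where
  "torus_smooth \<Gamma> f \<longleftrightarrow> smooth f \<and> (\<forall>z. \<forall>\<omega>\<in>\<Gamma>. f (z + \<omega>) = f z)"

definition partial_x :: "(complex \<Rightarrow> complex) \<Rightarrow> complex \<Rightarrow> complex" where
  "partial_x f z = vector_derivative (\<lambda>t. f (Complex t (Im z))) (at (Re z))"

definition partial_y :: "(complex \<Rightarrow> complex) \<Rightarrow> complex \<Rightarrow> complex" where
  "partial_y f z = vector_derivative (\<lambda>t. f (Complex (Re z) t)) (at (Im z))"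

definition d_z :: "(complex \<Rightarrow> complex) \<Rightarrow> complex \<Rightarrow> complex" where
  "d_z f z = (partial_x f z - \<i> * partial_y f z) / 2"

definition d_zbar :: "(complex \<Rightarrow> complex) \<Rightarrow> complex \<Rightarrow> complex" where
  "d_zbar f z = (partial_x f z + \<i> * partial_y f z) / 2"

definition top_solution :: "complex set \<Rightarrow> (complex \<Rightarrow> complex) \<Rightarrow> bool" where
  "top_solution \<Gamma> a \<longleftrightarrow> torus_smooth \<Gamma> a \<and> (\<forall>z. d_zbar a z = 0)"

text \<open>In \<open>step_solution \<Gamma> E g m b a\<close> the function \<open>b\<close> is the already chosen
  function of index \<open>2 m + 1\<close> and \<open>a\<close> is a solution of index \<open>2 m - 1\<close>.\<close>

definition step_solution ::
  "complex set \<Rightarrow> real \<Rightarrow> (complex \<Rightarrow> real) \<Rightarrow> nat \<Rightarrow>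
     (complex \<Rightarrow> complex) \<Rightarrow> (complex \<Rightarrow> complex) \<Rightarrow> bool" where
  "step_solution \<Gamma> E g m b a \<longleftrightarrow> torus_smooth \<Gamma> a \<and>
     (\<forall>z. d_zbar a z + complex_of_real (E / 2) *
            (of_nat (2 * m + 1) * b z * d_z (\<lambda>w. complex_of_real (g w)) z
              + complex_of_real (g z) * d_z b z) = 0)"

text \<open>A class of functions is determined up to an additive constant if any member \<open>u\<close>
  yields the whole class as the translates \<open>u + C\<close>; existence of a member is not included.\<close>

definition determined_up_to_constant :: "((complex \<Rightarrow> complex) \<Rightarrow> bool) \<Rightarrow> bool" where
  "determined_up_to_constant S \<longleftrightarrow>
     (\<forall>u. S u \<longrightarrow> (\<forall>v. S v \<longleftrightarrow> (\<exists>C. v = (\<lambda>z. u z + C))))"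

end

theory Submission
  imports Defs
begin

text \<open>On the torus the equation \<open>\<partial>u/\<partial>zbar = f\<close> has a smooth solution if and only if the
  mean of \<open>f\<close> vanishes: division of the Fourier coefficients of \<open>f\<close> by the symbol
  \<open>\<i> \<xi> / 2\<close> preserves rapid decay, and a function is determined by its Fourier coefficients
  (which also yields the constancy of the solutions of \<open>\<partial>a/\<partial>zbar = 0\<close>). After integration by
  parts, the mean condition for the equation with known function \<open>b\<close> becomes
  \<open>mean (b * g_z) = 0\<close>. Let \<open>h\<close> be a solution of \<open>\<partial>h/\<partial>zbar = g_z\<close>. If \<open>b\<close> is constant, or
  \<open>b = \<alpha> h + C\<close> as after the first step, then \<open>b * g_z\<close> is a zbar-derivative of a polynomial
  in \<open>h\<close>. For the third step the mean of \<open>b * \<partial>h/\<partial>zbar\<close> is, up to sign, that of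
  \<open>h * \<partial>b/\<partial>zbar\<close>; inserting the equation of the second step and integrating by parts once
  more leaves only means of \<open>h^n * \<partial>h/\<partial>zbar\<close>, which vanish.\<close>

subsection \<open>Smooth functions and directional derivatives\<close>

lemma frechet_derivative_eq:
  "(f has_derivative f') (at x) \<Longrightarrow> frechet_derivative f (at x) = f'"
  using frechet_derivative_at by metis

lemma times_cont_differentiable_continuous: "times_cont_differentiable n f \<Longrightarrow> continuous_on UNIV f"
  by (cases n)
    (auto simp: continuous_on_eq_continuous_at differentiable_imp_continuous_within)

lemma times_cont_differentiable_SucD:
  "times_cont_differentiable (Suc n) f \<Longrightarrow> times_cont_differentiable n f"
proof (induction n arbitrary: f)
  case 0
  then show ?case using times_cont_differentiable_continuous[OF 0] by simp
next
  case (Suc n)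
  then show ?case by (simp add: Suc.IH)
qed

lemma times_cont_differentiable_const: "times_cont_differentiable n (\<lambda>x. c)"
  by (induction n arbitrary: c) auto

lemma times_cont_differentiable_add:
  "times_cont_differentiable n f \<Longrightarrow> times_cont_differentiable n h \<Longrightarrow>
   times_cont_differentiable n (\<lambda>x. f x + h x)"
proof (induction n arbitrary: f h)
  case 0
  then show ?case by (auto intro: continuous_intros)
next
  case (Suc n)
  then have d: "\<And>x. f differentiable at x" "\<And>x. h differentiable at x" by auto
  have "frechet_derivative (\<lambda>x. f x + h x) (at x)
      = (\<lambda>v. frechet_derivative f (at x) v + frechet_derivative h (at x) v)" for x
    by (intro frechet_derivative_eq has_derivative_add)
      (use d frechet_derivative_works in blast)+
  then show ?case using Suc d by (auto intro: differentiable_add)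
qed

lemma (in bounded_linear) times_cont_differentiable_comp:
  "times_cont_differentiable n h \<Longrightarrow> times_cont_differentiable n (\<lambda>x. f (h x))"
proof (induction n arbitrary: h)
  case 0
  then show ?case by (auto intro: continuous_on)
next
  case (Suc n)
  then have d: "\<And>x. h differentiable at x" by auto
  have h: "((\<lambda>x. f (h x)) has_derivative (\<lambda>v. f (frechet_derivative h (at x) v))) (at x)" for x
    by (intro has_derivative) (use d frechet_derivative_works in blast)
  then show ?case using Suc frechet_derivative_eq[OF h]
    by (auto simp: differentiable_def)
qed

text \<open>Each Leibniz term keeps one factor undifferentiated;
  \<open>times_cont_differentiable_SucD\<close> lowers that factor to order \<open>n\<close>, so the
  induction hypothesis covers both terms.\<close>

lemma (in bounded_bilinear) times_cont_differentiable_prod: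
  "times_cont_differentiable n f \<Longrightarrow> times_cont_differentiable n h \<Longrightarrow>
   times_cont_differentiable n (\<lambda>x. prod (f x) (h x))"
proof (induction n arbitrary: f h)
  case 0
  then show ?case by (auto intro: continuous_on)
next
  case (Suc n)
  then have d: "\<And>x. f differentiable at x" "\<And>x. h differentiable at x" by auto
  have h: "((\<lambda>x. prod (f x) (h x)) has_derivative
      (\<lambda>v. prod (f x) (frechet_derivative h (at x) v) +
           prod (frechet_derivative f (at x) v) (h x))) (at x)" for x
    by (intro FDERIV) (use d frechet_derivative_works in blast)+
  have "times_cont_differentiable n (\<lambda>x. prod (f x) (frechet_derivative h (at x) v) +
      prod (frechet_derivative f (at x) v) (h x))" for v
    using Suc times_cont_differentiable_SucD[OF Suc.prems(1)]
      times_cont_differentiable_SucD[OF Suc.prems(2)]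
    by (intro times_cont_differentiable_add Suc.IH) auto
  then show ?case using frechet_derivative_eq[OF h] h by (auto simp: differentiable_def)
qed

lemma smooth_const: "smooth (\<lambda>x. c)"
  by (simp add: smooth_def times_cont_differentiable_const)

lemma smooth_add: "smooth f \<Longrightarrow> smooth h \<Longrightarrow> smooth (\<lambda>x. f x + h x)"
  by (simp add: smooth_def times_cont_differentiable_add)

lemma smooth_of_real: "smooth f \<Longrightarrow> smooth (\<lambda>x. complex_of_real (f x))"
  by (simp add: smooth_def bounded_linear.times_cont_differentiable_comp[OF bounded_linear_of_real])

lemma smooth_mult:
  fixes f h :: "'a::real_normed_vector \<Rightarrow> 'b::real_normed_algebra"
  shows "smooth f \<Longrightarrow> smooth h \<Longrightarrow> smooth (\<lambda>x. f x * h x)"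
  by (simp add: smooth_def bounded_bilinear.times_cont_differentiable_prod[OF bounded_bilinear_mult])

lemma smooth_differentiable: "smooth f \<Longrightarrow> f differentiable at x"
  unfolding smooth_def by (metis times_cont_differentiable.simps(2))

lemma smooth_has_derivative:
  "smooth f \<Longrightarrow> (f has_derivative frechet_derivative f (at x)) (at x)"
  using smooth_differentiable frechet_derivative_works by blast

lemma smooth_continuous_on: "smooth f \<Longrightarrow> continuous_on A f"
  by (meson smooth_def times_cont_differentiable_continuous continuous_on_subset subset_UNIV)

lemma smooth_directional_derivative:
  "smooth f \<Longrightarrow> smooth (\<lambda>x. frechet_derivative f (at x) v)"
  unfolding smooth_def by (metis times_cont_differentiable.simps(2))

text \<open>Smoothness is defined through Frechet derivatives in fixed directions, so the calculus
  is done with these; the partial derivatives in \<open>d_z\<close> and \<open>d_zbar\<close> are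
  translated once, with directions \<open>1\<close> and \<open>\<i>\<close>.\<close>

abbreviation ddir :: "(complex \<Rightarrow> complex) \<Rightarrow> complex \<Rightarrow> complex \<Rightarrow> complex" where
  "ddir f v \<equiv> \<lambda>z. frechet_derivative f (at z) v"

lemma ddir_mult:
  "smooth f \<Longrightarrow> smooth h \<Longrightarrow> ddir (\<lambda>z. f z * h z) v z = f z * ddir h v z + ddir f v z * h z"
  by (subst frechet_derivative_eq[OF has_derivative_mult])
    (auto intro: smooth_has_derivative)

lemma ddir_add:
  "smooth f \<Longrightarrow> smooth h \<Longrightarrow> ddir (\<lambda>z. f z + h z) v z = ddir f v z + ddir h v z"
  by (subst frechet_derivative_eq[OF has_derivative_add])
    (auto intro: smooth_has_derivative)

text \<open>Restriction to a line serves twice: to identify the partial derivatives, and for the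
  fundamental theorem of calculus along a period.\<close>

lemma smooth_line_has_vector_derivative:
  assumes "smooth f"
  shows "((\<lambda>t. f (a + t *\<^sub>R v)) has_vector_derivative ddir f v (a + t *\<^sub>R v)) (at t within S)"
proof -
  have "((\<lambda>t. a + t *\<^sub>R v) has_vector_derivative v) (at t within S)"
    by (auto intro!: derivative_eq_intros)
  from vector_derivative_diff_chain_within[OF this has_derivative_at_withinI[OF
      smooth_has_derivative[OF assms]]]
  show ?thesis by (simp add: o_def)
qed

lemma partial_x_eq_ddir:
  assumes "smooth f"
  shows "partial_x f z = ddir f 1 z"
proof -
  have e: "Complex t (Im z) = Complex 0 (Im z) + t *\<^sub>R 1" for t
    by (simp add: complex_eq_iff)
  have "((\<lambda>t. f (Complex t (Im z))) has_vector_derivative ddir f 1 z) (at (Re z))"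
    using smooth_line_has_vector_derivative[OF assms, of "Complex 0 (Im z)" 1 "Re z" UNIV]
    by (simp only: e[symmetric] complex.collapse)
  then show ?thesis by (simp add: partial_x_def vector_derivative_at)
qed

lemma partial_y_eq_ddir:
  assumes "smooth f"
  shows "partial_y f z = ddir f \<i> z"
proof -
  have e: "Complex (Re z) t = Complex (Re z) 0 + t *\<^sub>R \<i>" for t
    by (simp add: complex_eq_iff)
  have "((\<lambda>t. f (Complex (Re z) t)) has_vector_derivative ddir f \<i> z) (at (Im z))"
    using smooth_line_has_vector_derivative[OF assms, of "Complex (Re z) 0" \<i> "Im z" UNIV]
    by (simp only: e[symmetric] complex.collapse)
  then show ?thesis by (simp add: partial_y_def vector_derivative_at)
qed

lemma d_z_smooth: "smooth f \<Longrightarrow> d_z f z = (ddir f 1 z - \<i> * ddir f \<i> z) / 2"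
  and d_zbar_smooth: "smooth f \<Longrightarrow> d_zbar f z = (ddir f 1 z + \<i> * ddir f \<i> z) / 2"
  by (simp_all add: d_z_def d_zbar_def partial_x_eq_ddir partial_y_eq_ddir)

subsection \<open>Means and characters on a torus\<close>

text \<open>\<open>Im (cnj w1 * w2)\<close> is the determinant of the pair \<open>w1\<close>,
  \<open>w2\<close>, that is, the signed area of a period parallelogram.\<close>

locale torus =
  fixes w1 w2 :: complex
  assumes nondegenerate: "Im (cnj w1 * w2) \<noteq> 0"
begin

definition lat :: "complex set" where
  "lat = {of_int m * w1 + of_int n * w2 | (m::int) (n::int). True}"

definition cell_point :: "real \<times> real \<Rightarrow> complex" where
  "cell_point p = fst p *\<^sub>R w1 + snd p *\<^sub>R w2"

abbreviation unit_square :: "(real \<times> real) set" where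
  "unit_square \<equiv> cbox (0, 0) (1, 1)"

text \<open>Integrating in lattice coordinates normalises the average: constants are their own mean,
  whatever the area of the cell.\<close>

definition mean :: "(complex \<Rightarrow> complex) \<Rightarrow> complex" where
  "mean f = integral unit_square (\<lambda>p. f (cell_point p))"

abbreviation periodic :: "(complex \<Rightarrow> complex) \<Rightarrow> bool" where
  "periodic f \<equiv> \<forall>z. \<forall>\<omega>\<in>lat. f (z + \<omega>) = f z"

abbreviation tsmooth :: "(complex \<Rightarrow> complex) \<Rightarrow> bool" where
  "tsmooth \<equiv> torus_smooth lat"

lemma coordinates: "\<exists>a b. z = a *\<^sub>R w1 + b *\<^sub>R w2"
proof (intro exI)
  define A where "A = Im (cnj w1 * w2)"
  have A: "A \<noteq> 0" using nondegenerate by (simp add: A_def)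
  \<comment> \<open>Cramer's rule for the basis \<open>w1\<close>, \<open>w2\<close> with
    determinant \<open>A\<close>.\<close>
  have "A *\<^sub>R z = Im (cnj z * w2) *\<^sub>R w1 + Im (cnj w1 * z) *\<^sub>R w2"
    by (simp add: A_def complex_eq_iff algebra_simps)
  then have "z = inverse A *\<^sub>R (Im (cnj z * w2) *\<^sub>R w1 + Im (cnj w1 * z) *\<^sub>R w2)"
    using A by (metis scaleR_left.minus scaleR_one scaleR_scaleR left_inverse)
  then show "z = (inverse A * Im (cnj z * w2)) *\<^sub>R w1 + (inverse A * Im (cnj w1 * z)) *\<^sub>R w2"
    by (simp add: scaleR_add_right)
qed

lemma reduce_to_cell: "\<exists>p\<in>unit_square. \<exists>\<omega>\<in>lat. z = cell_point p + \<omega>"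
proof -
  obtain a b where z: "z = a *\<^sub>R w1 + b *\<^sub>R w2" using coordinates by blast
  show ?thesis
  proof (intro bexI)
    show "z = cell_point (frac a, frac b) + (of_int \<lfloor>a\<rfloor> * w1 + of_int \<lfloor>b\<rfloor> * w2)"
      by (simp add: z cell_point_def frac_def scaleR_conv_of_real algebra_simps)
    show "(frac a, frac b) \<in> unit_square"
      by (simp add: cbox_Pair_eq less_imp_le[OF frac_lt_1])
  qed (auto simp: lat_def)
qed

lemma continuous_on_cell_point: "continuous_on A cell_point"
  unfolding cell_point_def by (intro continuous_intros)

lemma continuous_on_comp_cell_point:
  "continuous_on UNIV f \<Longrightarrow> continuous_on A (\<lambda>p. f (cell_point p))"
  by (rule continuous_on_compose2[OF _ continuous_on_cell_point]) auto

lemma integrable_cell_point: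
  fixes f :: "complex \<Rightarrow> 'a::banach"
  shows "continuous_on UNIV f \<Longrightarrow> (\<lambda>p. f (cell_point p)) integrable_on unit_square"
  by (intro integrable_continuous continuous_on_comp_cell_point)

lemma mean_add:
  "continuous_on UNIV f \<Longrightarrow> continuous_on UNIV h \<Longrightarrow> mean (\<lambda>z. f z + h z) = mean f + mean h"
  unfolding mean_def by (intro integral_add integrable_cell_point)

lemma mean_diff:
  "continuous_on UNIV f \<Longrightarrow> continuous_on UNIV h \<Longrightarrow> mean (\<lambda>z. f z - h z) = mean f - mean h"
  unfolding mean_def by (intro integral_diff integrable_cell_point)

lemma mean_cmult: "mean (\<lambda>z. c * f z) = c * mean f"
  by (simp add: mean_def)

lemma mean_const: "mean (\<lambda>z. c) = c"
  by (simp add: mean_def content_Pair)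

lemma mean_bound:
  assumes "continuous_on UNIV f" "\<And>z. norm (f z) \<le> B"
  shows "norm (mean f) \<le> B"
proof -
  have "norm (mean f) \<le> integral unit_square (\<lambda>p. B)"
    unfolding mean_def using assms by (intro integral_norm_bound_integral integrable_cell_point) auto
  then show ?thesis by (simp add: content_Pair)
qed

lemma periodic_bounded:
  assumes "continuous_on UNIV f" "periodic f"
  obtains B where "B > 0" "\<And>z. norm (f z) \<le> B"
proof -
  have "compact ((\<lambda>p. f (cell_point p)) ` unit_square)"
    by (intro compact_continuous_image continuous_on_comp_cell_point assms compact_cbox)
  then obtain B where B: "B > 0" "\<And>p. p \<in> unit_square \<Longrightarrow> norm (f (cell_point p)) \<le> B"
    using compact_imp_bounded bounded_pos by (metis (no_types, lifting) imageI)
  have "norm (f z) \<le> B" for z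
    using reduce_to_cell[of z] B assms(2) by metis
  with B(1) show ?thesis using that by blast
qed

text \<open>Fubini in both orders, so that the inner integral can run along either period.\<close>

lemma mean_eq_iterated:
  assumes "continuous_on UNIV f"
  shows "mean f = integral {0..1} (\<lambda>s. integral {0..1} (\<lambda>t. f (s *\<^sub>R w1 + t *\<^sub>R w2)))"
    and "mean f = integral {0..1} (\<lambda>t. integral {0..1} (\<lambda>s. f (t *\<^sub>R w2 + s *\<^sub>R w1)))"
proof -
  have c: "continuous_on unit_square (\<lambda>p. f (cell_point p))"
    by (rule continuous_on_comp_cell_point[OF assms])
  show 1: "mean f = integral {0..1} (\<lambda>s. integral {0..1} (\<lambda>t. f (s *\<^sub>R w1 + t *\<^sub>R w2)))"
    using integral_prod_continuous[OF c] by (simp add: mean_def cell_point_def)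
  have "continuous_on unit_square (\<lambda>(s, t). f (s *\<^sub>R w1 + t *\<^sub>R w2))"
    using c by (simp add: cell_point_def case_prod_unfold)
  from integral_swap_continuous[OF this] 1
  show "mean f = integral {0..1} (\<lambda>t. integral {0..1} (\<lambda>s. f (t *\<^sub>R w2 + s *\<^sub>R w1)))"
    by (simp add: add.commute)
qed

lemma in_lat [simp]: "w1 \<in> lat" "w2 \<in> lat"
proof -
  have "w1 = of_int 1 * w1 + of_int 0 * w2" "w2 = of_int 0 * w1 + of_int 1 * w2" by auto
  then show "w1 \<in> lat" "w2 \<in> lat" unfolding lat_def by blast+
qed

lemma tsmoothD:
  "tsmooth f \<Longrightarrow> smooth f" "tsmooth f \<Longrightarrow> continuous_on UNIV f" "tsmooth f \<Longrightarrow> periodic f"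
  by (auto simp: torus_smooth_def smooth_continuous_on)

lemma tsmooth_const: "tsmooth (\<lambda>z. c)"
  by (simp add: torus_smooth_def smooth_const)

lemma tsmooth_add: "tsmooth f \<Longrightarrow> tsmooth h \<Longrightarrow> tsmooth (\<lambda>z. f z + h z)"
  by (simp add: torus_smooth_def smooth_add)

lemma tsmooth_mult: "tsmooth f \<Longrightarrow> tsmooth h \<Longrightarrow> tsmooth (\<lambda>z. f z * h z)"
  by (simp add: torus_smooth_def smooth_mult)

lemma tsmooth_cmult: "tsmooth f \<Longrightarrow> tsmooth (\<lambda>z. c * f z)"
  by (intro tsmooth_mult tsmooth_const)

lemma tsmooth_diff: "tsmooth f \<Longrightarrow> tsmooth h \<Longrightarrow> tsmooth (\<lambda>z. f z - h z)"
  using tsmooth_add[OF _ tsmooth_cmult[of h "-1"]] by simp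

lemma tsmooth_ddir:
  assumes "tsmooth f"
  shows "tsmooth (ddir f v)"
proof -
  have "ddir f v (z + \<omega>) = ddir f v z" if \<omega>: "\<omega> \<in> lat" for z \<omega>
  proof -
    have "((\<lambda>x. f (x + \<omega>)) has_derivative frechet_derivative f (at (z + \<omega>))) (at z)"
      by (rule has_derivative_compose[of "\<lambda>x. x + \<omega>" "\<lambda>v. v" z UNIV f])
        (auto intro!: derivative_eq_intros smooth_has_derivative tsmoothD(1) assms)
    moreover have "(\<lambda>x. f (x + \<omega>)) = f" using tsmoothD(3)[OF assms] \<omega> by auto
    ultimately show ?thesis by (metis frechet_derivative_eq)
  qed
  then show ?thesis using assms by (simp add: torus_smooth_def smooth_directional_derivative)
qed

text \<open>Along a period the fundamental theorem of calculus gives a difference of two equal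
  values; a general direction is a real combination of the two periods.\<close>

lemma mean_ddir:
  assumes f: "tsmooth f"
  shows "mean (ddir f v) = 0"
proof -
  have *: "integral {0..1} (\<lambda>t. ddir f w (a + t *\<^sub>R w)) = 0" if "w \<in> lat" for a w
  proof -
    have "((\<lambda>t. ddir f w (a + t *\<^sub>R w)) has_integral f (a + 1 *\<^sub>R w) - f (a + 0 *\<^sub>R w)) {0..1}"
      by (intro fundamental_theorem_of_calculus smooth_line_has_vector_derivative tsmoothD(1) f) auto
    then show ?thesis using tsmoothD(3)[OF f] that by (simp add: integral_unique)
  qed
  have c: "continuous_on UNIV (ddir f v)" for v
    by (intro tsmoothD tsmooth_ddir f)
  have w: "mean (ddir f w1) = 0" "mean (ddir f w2) = 0"
    by (subst mean_eq_iterated(2)[OF c] mean_eq_iterated(1)[OF c], simp add: *)+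
  obtain a b where v: "v = a *\<^sub>R w1 + b *\<^sub>R w2" using coordinates by blast
  have "ddir f v = (\<lambda>z. of_real a * ddir f w1 z + of_real b * ddir f w2 z)"
  proof
    fix z
    interpret bounded_linear "frechet_derivative f (at z)"
      using smooth_has_derivative[OF tsmoothD(1)[OF f]] has_derivative_bounded_linear by blast
    show "ddir f v z = of_real a * ddir f w1 z + of_real b * ddir f w2 z"
      unfolding v add scaleR by (simp add: scaleR_conv_of_real)
  qed
  then show ?thesis
    by (simp only:) (subst mean_add, auto intro!: continuous_intros c simp: mean_cmult w)
qed

text \<open>This is \<open>2 * pi\<close> times the dual lattice: exactly the \<open>\<xi>\<close>
  whose character \<open>chi \<xi>\<close> is periodic under \<open>lat\<close>.\<close>

definition freqs :: "complex set" where
  "freqs = {\<xi>. \<exists>m n. inner \<xi> w1 = 2 * pi * of_int m \<and> inner \<xi> w2 = 2 * pi * of_int n}"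

definition chi :: "complex \<Rightarrow> complex \<Rightarrow> complex" where
  "chi \<xi> z = cis (inner \<xi> z)"

lemma chi_0: "chi 0 z = 1"
  by (simp add: chi_def)

lemma chi_add: "chi (\<xi> + \<eta>) z = chi \<xi> z * chi \<eta> z"
  by (simp add: chi_def cis_mult inner_add_left)

lemma norm_chi [simp]: "norm (chi \<xi> z) = 1"
  by (simp add: chi_def)

lemma freqs_add: "\<xi> \<in> freqs \<Longrightarrow> \<eta> \<in> freqs \<Longrightarrow> \<xi> + \<eta> \<in> freqs"
  unfolding freqs_def by (clarsimp simp: inner_add_left) (metis distrib_left of_int_add)

lemma freqs_uminus: "\<xi> \<in> freqs \<Longrightarrow> - \<xi> \<in> freqs"
  unfolding freqs_def by (clarsimp simp: ) (metis mult_minus_right of_int_minus)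

lemma freqs_0: "0 \<in> freqs"
  unfolding freqs_def by (auto intro: exI[of _ 0])

lemma chi_has_derivative:
  "(chi \<xi> has_derivative (\<lambda>v. \<i> * of_real (inner \<xi> v) * chi \<xi> z)) (at z)"
proof -
  have "((\<lambda>z. \<i> * of_real (inner \<xi> z)) has_derivative (\<lambda>v. \<i> * of_real (inner \<xi> v))) (at z)"
    by (intro derivative_eq_intros | simp)+
  from has_derivative_compose[OF this has_field_derivative_imp_has_derivative[OF DERIV_exp]]
  have "((\<lambda>z. exp (\<i> * of_real (inner \<xi> z))) has_derivative
      (\<lambda>v. \<i> * of_real (inner \<xi> v) * exp (\<i> * of_real (inner \<xi> z)))) (at z)"
    by (simp add: mult.commute)
  then show ?thesis by (simp add: chi_def[abs_def] cis_conv_exp)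
qed

lemma ddir_chi: "ddir (chi \<xi>) v z = \<i> * of_real (inner \<xi> v) * chi \<xi> z"
  by (simp add: frechet_derivative_eq[OF chi_has_derivative])

lemma smooth_chi: "smooth (chi \<xi>)"
proof -
  \<comment> \<open>The factor \<open>c\<close> is carried along because differentiation only
    changes the constant in front of \<open>chi \<xi>\<close>, which closes the induction.\<close>
  have "times_cont_differentiable n (\<lambda>z. c * chi \<xi> z)" for n c
  proof (induction n arbitrary: c)
    case 0
    have "chi \<xi> differentiable at z" for z
      using chi_has_derivative differentiable_def by blast
    then have "continuous_on UNIV (chi \<xi>)"
      by (simp add: continuous_on_eq_continuous_at differentiable_imp_continuous_within)
    then show ?case by (auto intro!: continuous_intros)
  next
    case (Suc n)
    have d: "((\<lambda>z. c * chi \<xi> z) has_derivative (\<lambda>v. (c * \<i> * of_real (inner \<xi> v)) * chi \<xi> z)) (at z)" for z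
      using has_derivative_mult_right[OF chi_has_derivative] by (simp add: mult.assoc)
    show ?case using Suc d frechet_derivative_eq[OF d] by (auto simp: differentiable_def)
  qed
  from this[of _ 1] show ?thesis by (simp add: smooth_def)
qed

lemma tsmooth_chi:
  assumes "\<xi> \<in> freqs"
  shows "tsmooth (chi \<xi>)"
proof -
  have "chi \<xi> (z + \<omega>) = chi \<xi> z" if "\<omega> \<in> lat" for z \<omega>
  proof -
    obtain m n where m: "inner \<xi> w1 = 2 * pi * of_int m" "inner \<xi> w2 = 2 * pi * of_int n"
      using assms by (auto simp: freqs_def)
    obtain k l :: int where "\<omega> = of_int k * w1 + of_int l * w2"
      using \<open>\<omega> \<in> lat\<close> by (auto simp: lat_def)
    then have "\<omega> = of_int k *\<^sub>R w1 + of_int l *\<^sub>R w2" by (simp add: scaleR_conv_of_real)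
    then have "inner \<xi> \<omega> = 2 * pi * of_int (k * m + l * n)"
      by (simp add: inner_add_right m algebra_simps)
    then show ?thesis
      by (simp add: chi_def inner_add_right cis_mult[symmetric] cis_multiple_2pi)
  qed
  then show ?thesis by (simp add: torus_smooth_def smooth_chi)
qed

text \<open>For nonzero \<open>\<xi>\<close> the derivative of \<open>chi \<xi>\<close> in the
  direction \<open>\<xi>\<close> is a nonzero multiple of \<open>chi \<xi>\<close>, and derivatives
  have mean zero.\<close>

lemma mean_chi:
  assumes "\<xi> \<in> freqs"
  shows "mean (chi \<xi>) = (if \<xi> = 0 then 1 else 0)"
proof (cases "\<xi> = 0")
  case False
  have "0 = mean (ddir (chi \<xi>) \<xi>)" by (simp add: mean_ddir tsmooth_chi assms)
  also have "\<dots> = (\<i> * of_real (inner \<xi> \<xi>)) * mean (chi \<xi>)"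
    by (simp only: ddir_chi mean_cmult)
  finally show ?thesis using False by simp
qed (simp add: chi_0[abs_def] mean_const)

definition fourier_coeff :: "(complex \<Rightarrow> complex) \<Rightarrow> complex \<Rightarrow> complex" where
  "fourier_coeff f \<xi> = mean (\<lambda>z. f z * chi (- \<xi>) z)"

lemma mean_by_parts:
  assumes "tsmooth f" "tsmooth h"
  shows "mean (\<lambda>z. ddir f v z * h z) = - mean (\<lambda>z. f z * ddir h v z)"
proof -
  have "0 = mean (ddir (\<lambda>z. f z * h z) v)" by (simp add: mean_ddir tsmooth_mult assms)
  also have "\<dots> = mean (\<lambda>z. f z * ddir h v z + ddir f v z * h z)"
    by (simp add: ddir_mult tsmoothD assms)
  also have "\<dots> = mean (\<lambda>z. f z * ddir h v z) + mean (\<lambda>z. ddir f v z * h z)"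
    by (intro mean_add tsmoothD tsmooth_mult tsmooth_ddir assms)
  finally show ?thesis by (simp add: eq_neg_iff_add_eq_0 add.commute)
qed

lemma fourier_coeff_ddir:
  assumes "tsmooth f" "\<xi> \<in> freqs"
  shows "fourier_coeff (ddir f v) \<xi> = \<i> * of_real (inner \<xi> v) * fourier_coeff f \<xi>"
proof -
  have "fourier_coeff (ddir f v) \<xi> = - mean (\<lambda>z. f z * ddir (chi (- \<xi>)) v z)"
    unfolding fourier_coeff_def by (intro mean_by_parts tsmooth_chi freqs_uminus assms)
  also have "(\<lambda>z. f z * ddir (chi (- \<xi>)) v z)
    = (\<lambda>z. (- \<i> * of_real (inner \<xi> v)) * (f z * chi (- \<xi>) z))"
    by (simp add: ddir_chi fun_eq_iff)
  also have "mean \<dots> = (- \<i> * of_real (inner \<xi> v)) * fourier_coeff f \<xi>"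
    unfolding fourier_coeff_def by (rule mean_cmult)
  finally show ?thesis by simp
qed


subsection \<open>Uniqueness of Fourier coefficients\<close>

text \<open>A quarter turn of a period is orthogonal to it; the scaling makes \<open>dual1\<close>,
  \<open>dual2\<close> the basis dual to \<open>w1\<close>, \<open>w2\<close>, up to the factor
  \<open>2 * pi\<close>.\<close>

definition dual1 :: complex where
  "dual1 = (- 2 * pi / Im (cnj w1 * w2)) *\<^sub>R (\<i> * w2)"

definition dual2 :: complex where
  "dual2 = (2 * pi / Im (cnj w1 * w2)) *\<^sub>R (\<i> * w1)"

lemma inner_dual:
  "inner dual1 w1 = 2 * pi" "inner dual1 w2 = 0" "inner dual2 w1 = 0" "inner dual2 w2 = 2 * pi"
proof -
  define A where "A = Im (cnj w1 * w2)"
  have "inner (\<i> * w2) w1 = - A" "inner (\<i> * w1) w2 = A"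
    "inner (\<i> * w2) w2 = 0" "inner (\<i> * w1) w1 = 0"
    by (simp_all add: A_def inner_complex_def algebra_simps)
  moreover have "A \<noteq> 0" using nondegenerate by (simp add: A_def)
  ultimately show "inner dual1 w1 = 2 * pi" "inner dual1 w2 = 0"
      "inner dual2 w1 = 0" "inner dual2 w2 = 2 * pi"
    unfolding dual1_def dual2_def A_def[symmetric] by (simp_all del: scaleR_minus_left)
qed

lemma dual_in_freqs: "dual1 \<in> freqs" "dual2 \<in> freqs"
proof -
  have "inner dual1 w1 = 2 * pi * of_int 1" "inner dual1 w2 = 2 * pi * of_int 0"
    "inner dual2 w1 = 2 * pi * of_int 0" "inner dual2 w2 = 2 * pi * of_int 1"
    by (simp_all add: inner_dual)
  then show "dual1 \<in> freqs" "dual2 \<in> freqs" unfolding freqs_def by blast+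
qed

section \<open>The torus embedded as a product of two circles\<close>

definition torus_map :: "complex \<Rightarrow> complex \<times> complex" where
  "torus_map z = (chi dual1 z, chi dual2 z)"

abbreviation torus_set :: "(complex \<times> complex) set" where
  "torus_set \<equiv> sphere 0 1 \<times> sphere 0 1"

lemma torus_map_in: "torus_map z \<in> torus_set"
  by (simp add: torus_map_def)

text \<open>Angles with the same \<open>cis\<close> differ by integer multiples of
  \<open>2 * pi\<close>, so the two arguments of \<open>w\<close> differ by a lattice
  vector.\<close>

lemma periodic_cis_eq:
  assumes "periodic w" "cis a = cis a'" "cis b = cis b'"
  shows "w ((a / (2 * pi)) *\<^sub>R w1 + (b / (2 * pi)) *\<^sub>R w2)
       = w ((a' / (2 * pi)) *\<^sub>R w1 + (b' / (2 * pi)) *\<^sub>R w2)"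
proof -
  have *: "\<exists>k::int. a = a' + 2 * pi * k" if "cis a = cis a'" for a a'
  proof -
    have "sin a = sin a' \<and> cos a = cos a'" using that by (simp add: complex_eq_iff)
    then show ?thesis by (simp only: sin_cos_eq_iff)
  qed
  obtain k l :: int where k: "a = a' + 2 * pi * k" and l: "b = b' + 2 * pi * l"
    using * assms by metis
  have "(a / (2 * pi)) *\<^sub>R w1 + (b / (2 * pi)) *\<^sub>R w2
      = ((a' / (2 * pi)) *\<^sub>R w1 + (b' / (2 * pi)) *\<^sub>R w2) + (of_int k * w1 + of_int l * w2)"
    by (simp add: k l add_divide_distrib scaleR_conv_of_real algebra_simps)
  moreover have "of_int k * w1 + of_int l * w2 \<in> lat" by (auto simp: lat_def)
  ultimately show ?thesis using assms(1) by metis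
qed

text \<open>The function on a product of two circles induced by a periodic function. The jump of
  \<^const>\<open>Arg\<close> on the negative real axis is a multiple of \<open>2 pi\<close> and is absorbed by the periodicity.\<close>

definition descend :: "(complex \<Rightarrow> complex) \<Rightarrow> complex \<times> complex \<Rightarrow> complex" where
  "descend w p = w ((Arg (fst p) / (2 * pi)) *\<^sub>R w1 + (Arg (snd p) / (2 * pi)) *\<^sub>R w2)"

lemma cis_Arg_unit: "norm z = 1 \<Longrightarrow> cis (Arg z) = z"
  using cis_Arg[of z] by (cases "z = 0") (auto simp: sgn_div_norm)

lemma descend_torus_map:
  assumes "periodic w"
  shows "descend w (torus_map z) = w z"
proof -
  obtain s t where z: "z = s *\<^sub>R w1 + t *\<^sub>R w2" using coordinates by blast
  have i: "inner dual1 z = 2 * pi * s" "inner dual2 z = 2 * pi * t"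
    by (simp_all add: z inner_add_right inner_dual)
  have "descend w (torus_map z)
    = w ((2 * pi * s / (2 * pi)) *\<^sub>R w1 + (2 * pi * t / (2 * pi)) *\<^sub>R w2)"
    unfolding descend_def torus_map_def chi_def i fst_conv snd_conv
    by (intro periodic_cis_eq assms) (simp_all add: cis_Arg_unit)
  then show ?thesis by (simp add: z)
qed

lemma continuous_on_descend:
  assumes w: "periodic w" "continuous_on UNIV w"
  shows "continuous_on torus_set (descend w)"
  unfolding continuous_on_eq_continuous_within
proof
  fix p0 assume p0: "p0 \<in> torus_set"
  \<comment> \<open>Near \<open>p0\<close> the angle is continued from \<open>Arg\<close> of
    \<open>p0\<close> by that of the quotient, which stays near 1, where \<open>Arg\<close> is
    continuous. On \<open>torus_set\<close> both angles have the same \<open>cis\<close>, so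
    \<open>L\<close> agrees with \<open>descend w\<close>.\<close>
  define L where "L p = w (((Arg (fst p0) + Arg (fst p / fst p0)) / (2 * pi)) *\<^sub>R w1
      + ((Arg (snd p0) + Arg (snd p / snd p0)) / (2 * pi)) *\<^sub>R w2)" for p
  have nz: "fst p0 \<noteq> 0" "snd p0 \<noteq> 0" using p0 by auto
  have L: "L p = descend w p" if "p \<in> torus_set" for p
    unfolding L_def descend_def
    by (intro periodic_cis_eq w)
      (use that p0 nz in \<open>auto simp: cis_mult[symmetric] cis_Arg_unit norm_divide\<close>)
  have A: "isCont Arg 1" by (rule continuous_at_Arg) auto
  have c: "isCont (\<lambda>p. Arg (fst p / fst p0)) p0" "isCont (\<lambda>p. Arg (snd p / snd p0)) p0"
    by (rule isCont_o2[where g = Arg], use nz A in \<open>auto intro!: continuous_intros\<close>)+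
  have "isCont w z" for z using w(2) by (simp add: continuous_on_eq_continuous_at)
  then have "isCont L p0"
    unfolding L_def
    by (rule isCont_o2[where g = w, rotated])
      (intro isCont_add isCont_scaleR isCont_divide continuous_const c, simp_all)
  then have "continuous (at p0 within torus_set) L"
    by (rule continuous_at_imp_continuous_at_within)
  then show "continuous (at p0 within torus_set) (descend w)"
    by (rule continuous_transform_within[OF _ zero_less_one p0]) (simp add: L)
qed

section \<open>Functions orthogonal to every character\<close>

definition null :: "(complex \<Rightarrow> complex) \<Rightarrow> bool" where
  "null h \<longleftrightarrow> continuous_on UNIV h \<and> (\<forall>\<xi>\<in>freqs. mean (\<lambda>z. h z * chi \<xi> z) = 0)"

lemma continuous_on_chi [continuous_intros]: "continuous_on A (chi \<xi>)"
  by (rule smooth_continuous_on[OF smooth_chi])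

lemma null_add: "null f \<Longrightarrow> null h \<Longrightarrow> null (\<lambda>z. f z + h z)"
  by (auto simp: null_def distrib_right mean_add continuous_intros)

lemma null_cmult: "null h \<Longrightarrow> null (\<lambda>z. c * h z)"
  by (auto simp: null_def mult.assoc mean_cmult continuous_intros)

lemma null_mult_chi:
  assumes "null h" "\<eta> \<in> freqs"
  shows "null (\<lambda>z. h z * chi \<eta> z)"
  using assms freqs_add[OF assms(2)]
  by (auto simp: null_def mult.assoc chi_add[symmetric] continuous_intros)

text \<open>A real-linear functional of two complex variables is a combination of the coordinates
  and their conjugates, and along \<open>torus_map\<close> these are characters.\<close>

lemma null_mult_bounded_linear:
  assumes "bounded_linear (f :: complex \<times> complex \<Rightarrow> real)" "null h"
  shows "null (\<lambda>z. h z * of_real (f (torus_map z)))"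
proof -
  interpret bounded_linear f by fact
  \<comment> \<open>Chosen so that \<open>f (p, q)\<close> is twice the real part of
    \<open>\<alpha> * p + \<beta> * q\<close>.\<close>
  define \<alpha> \<beta> where "\<alpha> = Complex (f (1, 0)) (- f (\<i>, 0)) / 2"
    and "\<beta> = Complex (f (0, 1)) (- f (0, \<i>)) / 2"
  have "complex_of_real (f (p, q)) = \<alpha> * p + cnj \<alpha> * cnj p + (\<beta> * q + cnj \<beta> * cnj q)" for p q
  proof -
    have "(p, q) = Re p *\<^sub>R (1, 0) + Im p *\<^sub>R (\<i>, 0) + (Re q *\<^sub>R (0, 1) + Im q *\<^sub>R (0, \<i>))"
      by (simp add: complex_eq_iff)
    then have "f (p, q) = Re p * f (1, 0) + Im p * f (\<i>, 0) + (Re q * f (0, 1) + Im q * f (0, \<i>))"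
      by (metis add scaleR real_scaleR_def)
    then show ?thesis by (simp add: \<alpha>_def \<beta>_def complex_eq_iff field_simps)
  qed
  moreover have "cnj (chi \<xi> z) = chi (- \<xi>) z" for \<xi> z by (simp add: chi_def cis_cnj)
  ultimately have "(\<lambda>z. h z * of_real (f (torus_map z))) =
      (\<lambda>z. (\<alpha> * (h z * chi dual1 z) + cnj \<alpha> * (h z * chi (- dual1) z))
         + (\<beta> * (h z * chi dual2 z) + cnj \<beta> * (h z * chi (- dual2) z)))"
    by (simp add: torus_map_def fun_eq_iff algebra_simps)
  moreover have "null \<dots>"
    by (intro null_add null_cmult null_mult_chi dual_in_freqs freqs_uminus assms)
  ultimately show ?thesis by simp
qed

text \<open>A product is absorbed one factor at a time, the first factor turning \<open>h\<close>
  into a new null function; hence \<open>h\<close> is arbitrary in the induction.\<close>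

lemma null_mult_real_polynomial:
  assumes "real_polynomial_function f" "null h"
  shows "null (\<lambda>z. h z * of_real (f (torus_map z)))"
  using assms
proof (induction arbitrary: h rule: real_polynomial_function.induct)
  case (linear f)
  then show ?case by (rule null_mult_bounded_linear)
next
  case (const c)
  then show ?case using null_cmult[of h c] by (simp add: mult.commute)
next
  case (add f g)
  then show ?case using null_add[OF add.IH(1) add.IH(2)] by (simp add: distrib_left)
next
  case (mult f g)
  then show ?case using mult.IH(2)[OF mult.IH(1)] by (simp add: mult.assoc)
qed

lemma null_mult_polynomial:
  fixes g :: "complex \<times> complex \<Rightarrow> complex"
  assumes "polynomial_function g" "null h"
  shows "null (\<lambda>z. h z * g (torus_map z))"
proof -
  have "real_polynomial_function (Re \<circ> g)" "real_polynomial_function (Im \<circ> g)"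
    using assms(1) bounded_linear_Re bounded_linear_Im by (auto simp: polynomial_function_def)
  then have "null (\<lambda>z. h z * of_real ((Re \<circ> g) (torus_map z)) +
      \<i> * (h z * of_real ((Im \<circ> g) (torus_map z))))"
    by (intro null_add null_cmult null_mult_real_polynomial assms(2))
  moreover have "h z * g p = h z * of_real (Re (g p)) + \<i> * (h z * of_real (Im (g p)))" for z p
    by (simp add: complex_eq_iff)
  ultimately show ?thesis by simp
qed

text \<open>Stone-Weierstrass: \<open>cnj w\<close> is a uniform limit of trigonometric polynomials, to all of which
  \<open>w\<close> is orthogonal.\<close>

lemma null_imp_zero:
  assumes w: "periodic w" "null w"
  shows "w z = 0"
proof -
  have cw: "continuous_on UNIV w" using w(2) by (simp add: null_def)
  obtain B where B: "B > 0" "\<And>z. norm (w z) \<le> B" using periodic_bounded[OF cw w(1)] by blast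
  have pc: "periodic (\<lambda>z. cnj (w z))" using w(1) by simp
  have cc: "continuous_on UNIV (\<lambda>z. cnj (w z))" using cw by (intro continuous_intros)
  have "norm (mean (\<lambda>z. w z * cnj (w z))) \<le> 0 + e" if "e > 0" for e
  proof -
    have "\<exists>g. polynomial_function g \<and>
        (\<forall>p\<in>torus_set. norm (descend (\<lambda>z. cnj (w z)) p - g p) < e / B)"
      by (intro Stone_Weierstrass_polynomial_function compact_Times compact_sphere
          continuous_on_descend pc cc divide_pos_pos that B(1))
    then obtain g where g: "polynomial_function g"
        "\<And>p. p \<in> torus_set \<Longrightarrow> norm (descend (\<lambda>z. cnj (w z)) p - g p) < e / B"
      by auto
    have n: "null (\<lambda>z. w z * g (torus_map z))" by (rule null_mult_polynomial[OF g(1) w(2)])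
    then have cg: "continuous_on UNIV (\<lambda>z. w z * g (torus_map z))" by (simp add: null_def)
    have g0: "mean (\<lambda>z. w z * g (torus_map z)) = 0"
      using n freqs_0 by (auto simp: null_def chi_0)
    have b: "norm (cnj (w z) - g (torus_map z)) \<le> e / B" for z
      using g(2)[OF torus_map_in] descend_torus_map[OF pc] less_imp_le by metis
    have "norm (w z * cnj (w z) - w z * g (torus_map z)) \<le> e" for z
    proof -
      have "norm (w z * cnj (w z) - w z * g (torus_map z))
          = norm (w z) * norm (cnj (w z) - g (torus_map z))"
        by (simp add: norm_mult[symmetric] right_diff_distrib)
      also have "\<dots> \<le> B * (e / B)" using B b by (intro mult_mono) auto
      finally show ?thesis using B(1) by simp
    qed
    then have "norm (mean (\<lambda>z. w z * cnj (w z) - w z * g (torus_map z))) \<le> e"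
      by (intro mean_bound continuous_intros cw cc cg)
    then show ?thesis
      using g0 by (simp add: mean_diff[OF continuous_on_mult[OF cw cc] cg])
  qed
  then have "norm (mean (\<lambda>z. w z * cnj (w z))) \<le> 0" by (rule field_le_epsilon)
  moreover have "mean (\<lambda>z. w z * cnj (w z))
    = of_real (integral unit_square (\<lambda>p. (norm (w (cell_point p)))\<^sup>2))"
    unfolding mean_def complex_norm_square[symmetric]
    by (rule integral_unique, rule has_integral_of_real, rule integrable_integral,
        intro integrable_cell_point[of "\<lambda>z. (norm (w z))\<^sup>2"] continuous_intros cw)
  ultimately have "integral unit_square (\<lambda>p. (norm (w (cell_point p)))\<^sup>2) = 0" by simp
  \<comment> \<open>A continuous nonnegative function with zero integral vanishes on the square;
    \<open>reduce_to_cell\<close> then carries this to the plane.\<close>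
  then have 0: "\<forall>p\<in>unit_square. (norm (w (cell_point p)))\<^sup>2 = 0"
    by (subst (asm) integral_cbox_eq_0_iff)
      (auto simp: box_eq_empty Basis_prod_def intro!: continuous_intros continuous_on_comp_cell_point cw)
  show ?thesis using reduce_to_cell[of z] 0 w(1) by auto
qed


subsection \<open>Rapid decay\<close>

text \<open>Its Fourier multiplier \<open>1 + (norm \<xi>)\<^sup>2\<close> is the weight in which
  decay is measured below.\<close>

definition one_minus_laplace :: "(complex \<Rightarrow> complex) \<Rightarrow> complex \<Rightarrow> complex" where
  "one_minus_laplace f z = f z - (ddir (ddir f 1) 1 z + ddir (ddir f \<i>) \<i> z)"

lemma tsmooth_one_minus_laplace: "tsmooth f \<Longrightarrow> tsmooth (one_minus_laplace f)"
  unfolding one_minus_laplace_def[abs_def] by (intro tsmooth_diff tsmooth_add tsmooth_ddir)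

lemma fourier_coeff_add:
  "continuous_on UNIV f \<Longrightarrow> continuous_on UNIV h \<Longrightarrow> fourier_coeff (\<lambda>z. f z + h z) \<xi>
    = fourier_coeff f \<xi> + fourier_coeff h \<xi>"
  by (simp add: fourier_coeff_def distrib_right mean_add continuous_intros)

lemma fourier_coeff_diff:
  "continuous_on UNIV f \<Longrightarrow> continuous_on UNIV h \<Longrightarrow> fourier_coeff (\<lambda>z. f z - h z) \<xi>
    = fourier_coeff f \<xi> - fourier_coeff h \<xi>"
  by (simp add: fourier_coeff_def left_diff_distrib mean_diff continuous_intros)

lemma fourier_coeff_cmult: "fourier_coeff (\<lambda>z. c * f z) \<xi> = c * fourier_coeff f \<xi>"
  by (simp add: fourier_coeff_def mult.assoc mean_cmult)

lemma fourier_coeff_one_minus_laplace: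
  assumes "tsmooth f" "\<xi> \<in> freqs"
  shows "fourier_coeff (one_minus_laplace f) \<xi> = of_real (1 + (norm \<xi>)\<^sup>2) * fourier_coeff f \<xi>"
proof -
  note c = tsmoothD(2)[OF tsmooth_ddir[OF tsmooth_ddir[OF assms(1)]]]
  have "fourier_coeff (one_minus_laplace f) \<xi>
      = fourier_coeff f \<xi> - (fourier_coeff (ddir (ddir f 1) 1) \<xi> + fourier_coeff (ddir (ddir f \<i>) \<i>) \<xi>)"
    unfolding one_minus_laplace_def[abs_def] fourier_coeff_add[OF c c, symmetric]
    by (intro fourier_coeff_diff continuous_on_add c tsmoothD(2) assms)
  also have "\<dots> = fourier_coeff f \<xi> + (of_real (Re \<xi>))\<^sup>2 * fourier_coeff f \<xi>
      + (of_real (Im \<xi>))\<^sup>2 * fourier_coeff f \<xi>"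
    by (simp add: fourier_coeff_ddir tsmooth_ddir assms inner_complex_def power2_eq_square mult_ac)
  also have "\<dots> = of_real (1 + (norm \<xi>)\<^sup>2) * fourier_coeff f \<xi>"
    by (simp add: cmod_power2 algebra_simps)
  finally show ?thesis .
qed

text \<open>Coefficients of a bounded function are bounded; each application of
  \<open>one_minus_laplace\<close> gains one power of the weight.\<close>

lemma fourier_coeff_rapid_decay:
  assumes "tsmooth f"
  shows "\<exists>C. \<forall>\<xi>\<in>freqs. norm (fourier_coeff f \<xi>) * (1 + (norm \<xi>)\<^sup>2) ^ p \<le> C"
  using assms
proof (induction p arbitrary: f)
  case 0
  obtain B where B: "\<And>z. norm (f z) \<le> B"
    using periodic_bounded[OF tsmoothD(2,3)[OF 0]] by metis
  have "norm (fourier_coeff f \<xi>) \<le> B" for \<xi>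
    unfolding fourier_coeff_def
    by (intro mean_bound continuous_intros tsmoothD(2) 0) (simp add: norm_mult B)
  then show ?case by auto
next
  case (Suc p)
  obtain C where C:
    "\<forall>\<xi>\<in>freqs. norm (fourier_coeff (one_minus_laplace f) \<xi>) * (1 + (norm \<xi>)\<^sup>2) ^ p \<le> C"
    using Suc.IH[OF tsmooth_one_minus_laplace[OF Suc.prems]] by blast
  have e: "norm (fourier_coeff (one_minus_laplace f) \<xi>)
    = norm (fourier_coeff f \<xi>) * (1 + (norm \<xi>)\<^sup>2)" if "\<xi> \<in> freqs" for \<xi>
    by (simp add: fourier_coeff_one_minus_laplace[OF Suc.prems that] norm_mult norm_of_real
        del: of_real_add)
  then have "norm (fourier_coeff f \<xi>) * (1 + (norm \<xi>)\<^sup>2) ^ Suc p \<le> C" if "\<xi> \<in> freqs" for \<xi>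
    using bspec[OF C that] by (simp add: e that mult.assoc)
  then show ?case by blast
qed

section \<open>Enumeration of the frequencies by natural numbers, and summability over them\<close>

definition freq :: "nat \<Rightarrow> complex" where
  "freq k = (case prod_decode k of (a, b) \<Rightarrow>
     of_int (int_decode a) *\<^sub>R dual1 + of_int (int_decode b) *\<^sub>R dual2)"

lemma inner_freq:
  assumes "prod_decode k = (a, b)"
  shows "inner (freq k) w1 = 2 * pi * of_int (int_decode a)"
    "inner (freq k) w2 = 2 * pi * of_int (int_decode b)"
  by (simp_all add: freq_def assms inner_add_left inner_dual)

lemma freq_in: "freq k \<in> freqs"
  unfolding freqs_def using inner_freq by (cases "prod_decode k") blast

text \<open>The difference is orthogonal to both periods, which span the plane, hence to
  itself.\<close>

lemma inner_basis_eqI: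
  assumes "inner \<xi> w1 = inner \<eta> w1" "inner \<xi> w2 = inner \<eta> w2"
  shows "\<xi> = \<eta>"
proof -
  obtain a b where z: "\<xi> - \<eta> = a *\<^sub>R w1 + b *\<^sub>R w2" using coordinates by blast
  have "inner (\<xi> - \<eta>) (\<xi> - \<eta>) = 0"
    using assms by (subst (2) z) (simp add: inner_add_right inner_diff_left)
  then show ?thesis by simp
qed

lemma inj_freq: "inj freq"
proof
  fix k l assume e: "freq k = freq l"
  obtain a b where k: "prod_decode k = (a, b)" by fastforce
  obtain c d where l: "prod_decode l = (c, d)" by fastforce
  have "int_decode a = int_decode c" "int_decode b = int_decode d"
    using inner_freq[OF k] inner_freq[OF l] e by auto
  then have "prod_decode k = prod_decode l" by (simp add: k l int_decode_eq)
  then show "k = l" by (simp add: prod_decode_eq)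
qed

lemma surj_freq:
  assumes "\<xi> \<in> freqs"
  obtains k where "\<xi> = freq k"
proof -
  obtain m n where m: "inner \<xi> w1 = 2 * pi * of_int m" "inner \<xi> w2 = 2 * pi * of_int n"
    using assms by (auto simp: freqs_def)
  have "prod_decode (prod_encode (int_encode m, int_encode n)) = (int_encode m, int_encode n)"
    by simp
  from inner_freq[OF this] m show ?thesis
    using inner_basis_eqI that by (metis int_encode_inverse)
qed

text \<open>Cauchy-Schwarz, with the factor \<open>2 * pi\<close> weakened to 1. It bounds the
  integer coordinates of a frequency by its norm.\<close>

lemma int_sq_le_freq:
  assumes "inner \<xi> w = 2 * pi * of_int m"
  shows "(of_int m)\<^sup>2 \<le> (norm \<xi>)\<^sup>2 * (norm w)\<^sup>2"
proof -
  have "1 * \<bar>of_int m\<bar> \<le> 2 * pi * \<bar>real_of_int m\<bar>"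
    using pi_gt3 by (intro mult_right_mono) auto
  also have "\<dots> = \<bar>inner \<xi> w\<bar>" by (simp add: assms abs_mult)
  also have "\<dots> \<le> norm \<xi> * norm w" by (rule Cauchy_Schwarz_ineq2)
  finally have "\<bar>of_int m\<bar> \<le> norm \<xi> * norm w" by simp
  from power_mono[OF this, of 2] show ?thesis by (simp add: power_mult_distrib)
qed

lemma summable_int_decode: "summable (\<lambda>a. 1 / (1 + (real_of_int (int_decode a))\<^sup>2))"
proof (rule summable_comparison_test')
  have "summable (\<lambda>a. inverse ((real a)\<^sup>2))" by (rule inverse_power_summable) simp
  then have "summable (\<lambda>a. inverse ((real (Suc a))\<^sup>2))" by (subst summable_Suc_iff)
  then show "summable (\<lambda>a. 8 * inverse ((real (Suc a))\<^sup>2))" by (rule summable_mult)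
  fix a :: nat
  \<comment> \<open>\<open>int_decode a\<close> has absolute value \<open>a / 2\<close> for even
    \<open>a\<close> and \<open>(a + 1) / 2\<close> for odd \<open>a\<close>.\<close>
  have "real a / 2 \<le> \<bar>real_of_int (int_decode a)\<bar>"
    by (auto simp: int_decode_def sum_decode_def elim!: evenE oddE)
  from power_mono[OF this, of 2] have "(real a)\<^sup>2 / 4 \<le> (real_of_int (int_decode a))\<^sup>2"
    by (simp add: power_divide)
  \<comment> \<open>This gives \<open>(a + 1)^2 \<le> 2 * a^2 + 2\<close>; together with the
    preceding bound it produces the constant 8.\<close>
  moreover have "0 \<le> (real a - 1)\<^sup>2" by simp
  ultimately have "(real (Suc a))\<^sup>2 \<le> 8 * (1 + (real_of_int (int_decode a))\<^sup>2)"
    by (simp add: power2_eq_square algebra_simps)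
  then show "norm (1 / (1 + (real_of_int (int_decode a))\<^sup>2)) \<le> 8 * inverse ((real (Suc a))\<^sup>2)"
    by (simp add: field_simps add_pos_nonneg)
qed

text \<open>A finite set of pairs lies in the product of its projections, so every partial sum is at
  most the square of the sum of \<open>r\<close>.\<close>

lemma summable_prod_decode:
  fixes r :: "nat \<Rightarrow> real"
  assumes "summable r" "\<And>a. r a \<ge> 0"
  shows "summable (\<lambda>k. case prod_decode k of (a, b) \<Rightarrow> r a * r b)"
proof (rule summableI_nonneg_bounded)
  fix n
  let ?D = "prod_decode ` {..<n}"
  let ?A = "fst ` ?D" and ?B = "snd ` ?D"
  have "(\<Sum>k<n. case prod_decode k of (a, b) \<Rightarrow> r a * r b) = (\<Sum>(a, b)\<in>?D. r a * r b)"
    by (simp add: sum.reindex[OF inj_prod_decode] o_def)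
  also have "\<dots> \<le> (\<Sum>(a, b)\<in>?A \<times> ?B. r a * r b)"
    by (intro sum_mono2 subset_fst_snd) (auto simp: assms(2))
  also have "\<dots> = sum r ?A * sum r ?B"
    by (simp add: sum_product sum.cartesian_product)
  also have "\<dots> \<le> suminf r * suminf r"
    by (intro mult_mono sum_le_suminf assms suminf_nonneg sum_nonneg) auto
  finally show "(\<Sum>k<n. case prod_decode k of (a, b) \<Rightarrow> r a * r b) \<le> suminf r * suminf r" .
qed (auto simp: assms(2) split: prod.split)

text \<open>Each of the two integer coordinates is controlled by one factor
  \<open>1 + (norm (freq k))\<^sup>2\<close>, so the squared weight is dominated by a product of two
  summable one-dimensional weights.\<close>

lemma summable_freq: "summable (\<lambda>k. 1 / (1 + (norm (freq k))\<^sup>2)\<^sup>2)"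
proof (rule summable_comparison_test')
  define K where "K = 1 + (norm w1)\<^sup>2 + (norm w2)\<^sup>2"
  let ?r = "\<lambda>a. 1 / (1 + (real_of_int (int_decode a))\<^sup>2)"
  show "summable (\<lambda>k. K\<^sup>2 * (case prod_decode k of (a, b) \<Rightarrow> ?r a * ?r b))"
    by (intro summable_mult summable_prod_decode summable_int_decode) simp
  fix k :: nat
  obtain a b where ab: "prod_decode k = (a, b)" by fastforce
  let ?x = "(norm (freq k))\<^sup>2"
  have *: "1 + (of_int m)\<^sup>2 \<le> K * (1 + ?x)"
    if "inner (freq k) w = 2 * pi * of_int m" "(norm w)\<^sup>2 \<le> K - 1" for w and m :: int
  proof -
    have "(of_int m)\<^sup>2 \<le> ?x * (norm w)\<^sup>2" by (rule int_sq_le_freq[OF that(1)])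
    also have "\<dots> \<le> ?x * K" using that(2) by (intro mult_left_mono) auto
    finally have "(of_int m)\<^sup>2 \<le> ?x * K" .
    moreover have "1 \<le> K" using that(2) zero_le_power2[of "norm w"] by linarith
    ultimately show ?thesis by (simp add: algebra_simps)
  qed
  have "(1 + (of_int (int_decode a))\<^sup>2) * (1 + (of_int (int_decode b))\<^sup>2)
    \<le> (K * (1 + ?x)) * (K * (1 + ?x))"
    by (intro mult_mono *[OF inner_freq(1)[OF ab]] *[OF inner_freq(2)[OF ab]])
      (auto simp: K_def intro!: mult_nonneg_nonneg add_nonneg_nonneg)
  then have "1 / (1 + ?x)\<^sup>2 \<le> K\<^sup>2 * (?r a * ?r b)"
    by (simp add: divide_simps power2_eq_square add_pos_nonneg mult_ac add_nonneg_eq_0_iff)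
  then show "norm (1 / (1 + ?x)\<^sup>2) \<le> K\<^sup>2 * (case prod_decode k of (a, b) \<Rightarrow> ?r a * ?r b)"
    by (simp add: ab)
qed

text \<open>A nonzero frequency has a nonzero integer coordinate, so frequencies cannot approach
  zero. This gap controls the division by \<open>\<xi>\<close>.\<close>

lemma norm_freq_bound:
  assumes "\<xi> \<in> freqs" "\<xi> \<noteq> 0"
  shows "1 \<le> (1 + (norm w1)\<^sup>2 + (norm w2)\<^sup>2) * (norm \<xi>)\<^sup>2"
proof -
  obtain m n where m: "inner \<xi> w1 = 2 * pi * of_int m" "inner \<xi> w2 = 2 * pi * of_int n"
    using assms by (auto simp: freqs_def)
  have "m \<noteq> 0 \<or> n \<noteq> 0" using m inner_basis_eqI[of \<xi> 0] assms(2) by auto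
  then have "1 \<le> m\<^sup>2 + n\<^sup>2"
    by (smt (verit) zero_less_power2 zero_le_power2)
  then have "1 \<le> (real_of_int m)\<^sup>2 + (real_of_int n)\<^sup>2"
    by (metis of_int_1_le_iff of_int_add of_int_power)
  also have "\<dots> \<le> (norm \<xi>)\<^sup>2 * (norm w1)\<^sup>2 + (norm \<xi>)\<^sup>2 * (norm w2)\<^sup>2"
    by (intro add_mono int_sq_le_freq m)
  also have "\<dots> \<le> (1 + (norm w1)\<^sup>2 + (norm w2)\<^sup>2) * (norm \<xi>)\<^sup>2"
    by (simp add: algebra_simps)
  finally show ?thesis .
qed


subsection \<open>Fourier series and the equation for the zbar-derivative\<close>

definition rapid :: "(nat \<Rightarrow> complex) \<Rightarrow> bool" where
  "rapid c \<longleftrightarrow> (\<forall>p. \<exists>C. \<forall>k. norm (c k) * (1 + (norm (freq k))\<^sup>2) ^ p \<le> C)"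

text \<open>A multiplier of first order in the weight costs one power of decay: the bound for
  \<open>Suc p\<close> yields the one for \<open>p\<close>.\<close>

lemma rapid_mult:
  assumes "rapid c" "\<And>k. norm (d k) \<le> K * (1 + (norm (freq k))\<^sup>2)"
  shows "rapid (\<lambda>k. d k * c k)"
  unfolding rapid_def
proof
  fix p
  obtain C where C: "norm (c k) * (1 + (norm (freq k))\<^sup>2) ^ Suc p \<le> C" for k
    using assms(1) unfolding rapid_def by metis
  \<comment> \<open>The sign of \<open>K\<close> is read off from the hypothesis at index 0.\<close>
  have "0 \<le> K * (1 + (norm (freq 0))\<^sup>2)" using assms(2)[of 0] norm_ge_zero[of "d 0"] by linarith
  moreover have "0 < 1 + (norm (freq 0))\<^sup>2" by (simp add: add_pos_nonneg)
  ultimately have K: "K \<ge> 0" by (auto simp: zero_le_mult_iff)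
  have "norm (d k * c k) * (1 + (norm (freq k))\<^sup>2) ^ p \<le> K * C" for k
  proof -
    let ?x = "1 + (norm (freq k))\<^sup>2"
    have "norm (d k * c k) * ?x ^ p \<le> (K * ?x) * (norm (c k) * ?x ^ p)"
      unfolding norm_mult mult.assoc[of "norm (d k)"]
      by (intro mult_right_mono assms(2) mult_nonneg_nonneg zero_le_power add_nonneg_nonneg) auto
    also have "\<dots> = K * (norm (c k) * ?x ^ Suc p)" by simp
    also have "\<dots> \<le> K * C" by (intro mult_left_mono C K)
    finally show ?thesis .
  qed
  then show "\<exists>C. \<forall>k. norm (d k * c k) * (1 + (norm (freq k))\<^sup>2) ^ p \<le> C" by blast
qed

lemma rapid_summable:
  assumes "rapid c"
  shows "summable (\<lambda>k. norm (c k))"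
proof -
  obtain C where C: "norm (c k) * (1 + (norm (freq k))\<^sup>2) ^ 2 \<le> C" for k
    using assms unfolding rapid_def by metis
  have "norm (norm (c k)) \<le> C * (1 / (1 + (norm (freq k))\<^sup>2)\<^sup>2)" for k
  proof -
    have "0 < (1 + (norm (freq k))\<^sup>2)\<^sup>2" by (simp add: add_nonneg_eq_0_iff)
    from pos_le_divide_eq[OF this] C[of k] show ?thesis by simp
  qed
  then show ?thesis
    by (intro summable_comparison_test'[OF summable_mult[OF summable_freq]])
qed

section \<open>Termwise differentiation and coefficients of Fourier series\<close>

definition fourier_series :: "(nat \<Rightarrow> complex) \<Rightarrow> complex \<Rightarrow> complex" where
  "fourier_series c z = (\<Sum>k. c k * chi (freq k) z)"

abbreviation dcoeff :: "complex \<Rightarrow> (nat \<Rightarrow> complex) \<Rightarrow> nat \<Rightarrow> complex" where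
  "dcoeff v c \<equiv> \<lambda>k. (\<i> * of_real (inner (freq k) v)) * c k"

lemma norm_le_one_plus_square: "norm (x :: complex) \<le> 1 + (norm x)\<^sup>2"
proof -
  have "0 \<le> (norm x - 1)\<^sup>2" by simp
  then have "2 * norm x \<le> 1 + (norm x)\<^sup>2" by (simp add: power2_eq_square algebra_simps)
  then show ?thesis using norm_ge_zero[of x] by linarith
qed

lemma rapid_dcoeff: "rapid c \<Longrightarrow> rapid (dcoeff v c)"
proof (rule rapid_mult)
  fix k
  have "norm (\<i> * complex_of_real (inner (freq k) v)) \<le> norm (freq k) * norm v"
    by (simp add: norm_mult Cauchy_Schwarz_ineq2)
  also have "\<dots> \<le> norm v * (1 + (norm (freq k))\<^sup>2)"
    unfolding mult.commute[of _ "norm v"] by (intro mult_left_mono norm_le_one_plus_square) auto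
  finally show "norm (\<i> * complex_of_real (inner (freq k) v))
    \<le> norm v * (1 + (norm (freq k))\<^sup>2)" .
qed

lemma fourier_series_summable:
  assumes "rapid c"
  shows "summable (\<lambda>k. c k * chi (freq k) z)"
  by (rule summable_norm_cancel) (use rapid_summable[OF assms] in \<open>simp add: norm_mult\<close>)

text \<open>The bound depends only on the majorant \<open>a\<close>, hence is uniform in the point
  at which a series is evaluated.\<close>

lemma fourier_series_tail:
  fixes b :: "nat \<Rightarrow> complex"
  assumes "summable a" "\<And>k. norm (b k) \<le> a k"
  shows "norm ((\<Sum>k<n. b k) - suminf b) \<le> (\<Sum>k. a (k + n))"
proof -
  have sb: "summable b" by (rule summable_comparison_test'[OF assms])
  have "norm ((\<Sum>k<n. b k) - suminf b) = norm (\<Sum>k. b (k + n))"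
    by (simp add: suminf_split_initial_segment[OF sb, of n])
  also have "\<dots> \<le> (\<Sum>k. a (k + n))"
    by (intro norm_suminf_le assms summable_ignore_initial_segment)
  finally show ?thesis .
qed

lemma fourier_series_has_derivative:
  assumes c: "rapid c"
  shows "(fourier_series c has_derivative (\<lambda>v. fourier_series (dcoeff v c) z)) (at z)"
proof -
  \<comment> \<open>By Cauchy-Schwarz \<open>a k * norm v\<close> dominates the differentiated terms
    at every point, which gives the uniform convergence needed for termwise differentiation.\<close>
  define a where "a k = norm (of_real (norm (freq k)) * c k)" for k
  have sa: "summable a"
    unfolding a_def by (intro rapid_summable rapid_mult[OF c, of _ 1])
      (simp add: norm_le_one_plus_square)
  have "\<exists>g. \<forall>x\<in>UNIV. (\<lambda>k. c k * chi (freq k) x) sums g x \<and>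
      (g has_derivative (\<lambda>v. fourier_series (dcoeff v c) x)) (at x within UNIV)"
  proof (rule has_derivative_series)
    show "((\<lambda>z. c k * chi (freq k) z) has_derivative
        (\<lambda>v. dcoeff v c k * chi (freq k) x)) (at x within UNIV)" for k x
      using has_derivative_mult_right[OF chi_has_derivative, of "c k" "freq k" x]
      by (simp add: mult_ac)
    show "(\<lambda>k. c k * chi (freq k) 0) sums fourier_series c 0"
      unfolding fourier_series_def using fourier_series_summable[OF c] by (rule summable_sums)
    fix e :: real assume "e > 0"
    then obtain N where N: "\<forall>n\<ge>N. norm (\<Sum>k. a (k + n)) < e"
      using suminf_exist_split[OF _ sa] by blast
    have "norm ((\<Sum>k<n. dcoeff v c k * chi (freq k) x) - fourier_series (dcoeff v c) x)
      \<le> e * norm v"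
      if "n \<ge> N" for n x v
    proof -
      have "norm ((\<Sum>k<n. dcoeff v c k * chi (freq k) x) - fourier_series (dcoeff v c) x)
          \<le> (\<Sum>k. a (k + n) * norm v)"
        unfolding fourier_series_def
      proof (rule fourier_series_tail)
        show "summable (\<lambda>k. a k * norm v)" by (rule summable_mult2[OF sa])
        fix k
        have "\<bar>inner (freq k) v\<bar> * norm (c k) \<le> (norm (freq k) * norm v) * norm (c k)"
          by (intro mult_right_mono Cauchy_Schwarz_ineq2) auto
        then show "norm (dcoeff v c k * chi (freq k) x) \<le> a k * norm v"
          by (simp add: a_def norm_mult mult_ac)
      qed
      also have "\<dots> = (\<Sum>k. a (k + n)) * norm v"
        by (rule suminf_mult2[symmetric, OF summable_ignore_initial_segment[OF sa]])
      also have "\<dots> \<le> e * norm v"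
        using N that by (intro mult_right_mono) (auto simp: less_imp_le abs_le_iff dest!: spec[of _ n])
      finally show ?thesis .
    qed
    then show "\<forall>\<^sub>F n in sequentially. \<forall>x\<in>UNIV. \<forall>v.
        norm ((\<Sum>k<n. dcoeff v c k * chi (freq k) x) - fourier_series (dcoeff v c) x) \<le> e * norm v"
      unfolding eventually_sequentially by blast
  qed auto
  then obtain g where g: "\<And>x. (\<lambda>k. c k * chi (freq k) x) sums g x"
      "\<And>x. (g has_derivative (\<lambda>v. fourier_series (dcoeff v c) x)) (at x)" by auto
  have "g = fourier_series c" using g(1) sums_unique by (auto simp: fourier_series_def fun_eq_iff)
  with g(2) show ?thesis by simp
qed

text \<open>Every directional derivative is again a Fourier series with rapidly decaying
  coefficients, so the induction runs over all such \<open>c\<close> at once; periodicity comes from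
  the characters.\<close>

lemma tsmooth_fourier_series:
  assumes "rapid c"
  shows "tsmooth (fourier_series c)"
proof -
  have "times_cont_differentiable n (fourier_series c)" if "rapid c" for n c
    using that
  proof (induction n arbitrary: c)
    case 0
    then have "fourier_series c differentiable at z" for z
      using fourier_series_has_derivative differentiable_def by blast
    then show ?case
      by (simp add: continuous_on_eq_continuous_at differentiable_imp_continuous_within)
  next
    case (Suc n)
    note d = fourier_series_has_derivative[OF Suc.prems]
    have "(\<lambda>x. fourier_series (dcoeff v c) x) = fourier_series (dcoeff v c)" for v ..
    then show ?case using Suc.IH[OF rapid_dcoeff[OF Suc.prems]] d
      by (simp add: frechet_derivative_eq[OF d]) (use differentiable_def in blast)
  qed
  moreover have "fourier_series c (z + \<omega>) = fourier_series c z" if "\<omega> \<in> lat" for z \<omega>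
    using tsmoothD(3)[OF tsmooth_chi[OF freq_in]] that by (simp add: fourier_series_def)
  ultimately show ?thesis using assms by (simp add: torus_smooth_def smooth_def)
qed

lemma fourier_coeff_chi:
  "\<eta> \<in> freqs \<Longrightarrow> \<xi> \<in> freqs \<Longrightarrow> fourier_coeff (chi \<eta>) \<xi> = (if \<eta> = \<xi> then 1 else 0)"
  using mean_chi[OF freqs_add[OF _ freqs_uminus], of \<eta> \<xi>]
  by (simp add: fourier_coeff_def chi_add[symmetric])

text \<open>Orthogonality gives the coefficients of the partial sums, and uniform convergence passes
  them to the limit.\<close>

lemma fourier_coeff_fourier_series:
  assumes c: "rapid c"
  shows "fourier_coeff (fourier_series c) (freq j) = c j"
proof -
  have cs: "continuous_on UNIV (fourier_series c)" by (intro tsmoothD(2) tsmooth_fourier_series c)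
  define s where "s n z = (\<Sum>k<n. c k * chi (freq k) z)" for n z
  have cn: "continuous_on UNIV (s n)" for n
    unfolding s_def[abs_def] by (intro continuous_intros)
  have fs: "fourier_coeff (s n) (freq j) = (\<Sum>k<n. if k = j then c j else 0)" for n
  proof (induction n)
    case 0
    then show ?case by (simp add: s_def[abs_def] fourier_coeff_def mean_const)
  next
    case (Suc n)
    have "s (Suc n) = (\<lambda>z. s n z + c n * chi (freq n) z)" by (simp add: s_def fun_eq_iff)
    then have "fourier_coeff (s (Suc n)) (freq j)
      = fourier_coeff (s n) (freq j) + c n * fourier_coeff (chi (freq n)) (freq j)"
      by (simp add: fourier_coeff_add fourier_coeff_cmult cn continuous_intros)
    then show ?case using Suc by (auto simp: fourier_coeff_chi freq_in dest: injD[OF inj_freq])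
  qed
  have "norm (fourier_coeff (fourier_series c) (freq j) - c j) \<le> 0 + e" if "e > 0" for e
  proof -
    obtain N where N: "\<forall>n\<ge>N. norm (\<Sum>k. norm (c (k + n))) < e"
      using suminf_exist_split[OF \<open>e > 0\<close> rapid_summable[OF c]] by blast
    \<comment> \<open>From \<open>N\<close> on the tail is below \<open>e\<close>; from
      \<open>Suc j\<close> on the partial sum contains the term of index \<open>j\<close>.\<close>
    define n where "n = max N (Suc j)"
    have "norm (s n z - fourier_series c z) \<le> (\<Sum>k. norm (c (k + n)))" for z
      unfolding s_def fourier_series_def
      by (rule fourier_series_tail[OF rapid_summable[OF c]]) (simp add: norm_mult)
    also have "(\<Sum>k. norm (c (k + n))) \<le> e" using N[rule_format, of n] by (simp add: n_def)
    finally have b: "norm (s n z - fourier_series c z) \<le> e" for z .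
    have "norm (fourier_coeff (\<lambda>z. s n z - fourier_series c z) (freq j)) \<le> e"
      unfolding fourier_coeff_def by (intro mean_bound continuous_intros cn cs)
        (simp add: norm_mult b)
    moreover have "fourier_coeff (\<lambda>z. s n z - fourier_series c z) (freq j)
      = c j - fourier_coeff (fourier_series c) (freq j)"
      by (simp add: fourier_coeff_diff cn cs fs) (simp add: n_def sum.delta)
    ultimately show ?thesis by (simp add: norm_minus_commute)
  qed
  then have "norm (fourier_coeff (fourier_series c) (freq j) - c j)
    \<le> 0" by (rule field_le_epsilon)
  then show ?thesis by simp
qed

lemma fourier_coeff_zero_imp_zero:
  assumes "tsmooth f" "\<And>\<xi>. \<xi> \<in> freqs \<Longrightarrow> fourier_coeff f \<xi> = 0"
  shows "f z = 0"
proof (rule null_imp_zero[where w = f])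
  have "mean (\<lambda>z. f z * chi \<xi> z) = 0" if "\<xi> \<in> freqs" for \<xi>
    using assms(2)[OF freqs_uminus[OF that]] by (simp add: fourier_coeff_def)
  then show "null f" using assms(1) by (simp add: null_def tsmoothD)
qed (use assms tsmoothD in blast)

section \<open>The zbar-derivative on the Fourier side: kernel and range\<close>

lemma d_zbar_eq: "tsmooth f \<Longrightarrow> d_zbar f = (\<lambda>z. (1 / 2) * (ddir f 1 z + \<i> * ddir f \<i> z))"
  and d_z_eq: "tsmooth f \<Longrightarrow> d_z f = (\<lambda>z. (1 / 2) * (ddir f 1 z + (- \<i>) * ddir f \<i> z))"
  by (simp_all add: fun_eq_iff d_zbar_smooth d_z_smooth tsmoothD)

lemma tsmooth_d_zbar: "tsmooth f \<Longrightarrow> tsmooth (d_zbar f)"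
  by (simp only: d_zbar_eq) (intro tsmooth_cmult tsmooth_add tsmooth_ddir)

lemma tsmooth_d_z: "tsmooth f \<Longrightarrow> tsmooth (d_z f)"
  by (simp only: d_z_eq) (intro tsmooth_cmult tsmooth_add tsmooth_ddir)

text \<open>The directions \<open>1\<close> and \<open>\<i>\<close> contribute
  \<open>Re \<xi>\<close> and \<open>\<i> * Im \<xi>\<close>, which add up to the frequency itself
  as a complex number. The symbol thus vanishes only at zero.\<close>

lemma fourier_coeff_d_zbar:
  assumes "tsmooth f" "\<xi> \<in> freqs"
  shows "fourier_coeff (d_zbar f) \<xi> = (\<i> / 2) * \<xi> * fourier_coeff f \<xi>"
proof -
  have "fourier_coeff (d_zbar f) \<xi>
    = (1 / 2) * (fourier_coeff (ddir f 1) \<xi> + \<i> * fourier_coeff (ddir f \<i>) \<xi>)"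
    unfolding d_zbar_eq[OF assms(1)] fourier_coeff_cmult
    by (subst fourier_coeff_add)
      (simp_all add: fourier_coeff_cmult tsmoothD(2) tsmooth_ddir tsmooth_cmult assms)
  also have "\<dots> = (\<i> / 2) * (of_real (Re \<xi>) + \<i> * of_real (Im \<xi>)) * fourier_coeff f \<xi>"
    by (simp add: fourier_coeff_ddir assms inner_complex_def algebra_simps)
  finally show ?thesis by (simp add: complex_eq[symmetric])
qed

lemma fourier_coeff_0: "fourier_coeff f 0 = mean f"
  by (simp add: fourier_coeff_def chi_0)

lemma d_zbar_solvable:
  assumes f: "tsmooth f" "mean f = 0"
  obtains u where "tsmooth u" "d_zbar u = f"
proof -
  \<comment> \<open>The inverse of the symbol \<open>\<i> * \<xi> / 2\<close>. At frequency zero any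
    value would do, since the coefficient of \<open>f\<close> there is its mean, which is
    zero.\<close>
  define d where "d k = (if freq k = 0 then 0 else 2 / (\<i> * freq k))" for k
  define c where "c k = d k * fourier_coeff f (freq k)" for k
  have "rapid (\<lambda>k. fourier_coeff f (freq k))"
    unfolding rapid_def using fourier_coeff_rapid_decay[OF f(1)] freq_in by meson
  \<comment> \<open>The gap around the zero frequency bounds the inverse symbol, so that
    \<open>rapid_mult\<close> applies.\<close>
  moreover have "norm (d k) \<le> (2 * (1 + (norm w1)\<^sup>2 + (norm w2)\<^sup>2)) * (1 + (norm (freq k))\<^sup>2)"
    for k
  proof (cases "freq k = 0")
    case False
    define K x where "K = 1 + (norm w1)\<^sup>2 + (norm w2)\<^sup>2" and "x = norm (freq k)"
    have K: "1 \<le> K * x\<^sup>2" unfolding K_def x_def by (rule norm_freq_bound[OF freq_in False])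
    have x: "x > 0" "x \<le> 1 + x\<^sup>2" using False norm_le_one_plus_square by (auto simp: x_def)
    have "0 \<le> K" by (simp add: K_def)
    have "1 / x \<le> K * x" using K x by (simp add: divide_simps power2_eq_square mult_ac)
    also have "\<dots> \<le> K * (1 + x\<^sup>2)" using x \<open>0 \<le> K\<close> by (intro mult_left_mono)
    finally have "2 * (1 / x) \<le> 2 * (K * (1 + x\<^sup>2))" by simp
    moreover have "norm (d k) = 2 * (1 / x)"
      using False by (simp add: d_def norm_divide norm_mult x_def)
    ultimately show ?thesis by (simp only: x_def K_def mult.assoc)
  qed (simp add: d_def)
  ultimately have c: "rapid c" unfolding c_def[abs_def] by (rule rapid_mult)
  have u: "tsmooth (fourier_series c)" by (rule tsmooth_fourier_series[OF c])
  have "d_zbar (fourier_series c) z - f z = 0" for z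
  proof (rule fourier_coeff_zero_imp_zero[where f = "\<lambda>z. d_zbar (fourier_series c) z - f z"])
    show "tsmooth (\<lambda>z. d_zbar (fourier_series c) z - f z)" by (intro tsmooth_diff tsmooth_d_zbar u f)
    fix \<xi> assume "\<xi> \<in> freqs"
    then obtain k where k: "\<xi> = freq k" using surj_freq by blast
    have "fourier_coeff (\<lambda>z. d_zbar (fourier_series c) z - f z) \<xi>
      = (\<i> / 2) * freq k * c k - fourier_coeff f (freq k)"
      by (simp add: fourier_coeff_diff tsmoothD(2) tsmooth_d_zbar u f fourier_coeff_d_zbar k
          freq_in fourier_coeff_fourier_series c)
    also have "\<dots> = 0" using f(2) fourier_coeff_0[of f] by (simp add: c_def d_def)
    finally show "fourier_coeff (\<lambda>z. d_zbar (fourier_series c) z - f z) \<xi> = 0" .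
  qed
  then show ?thesis using that[OF u] by (simp add: fun_eq_iff)
qed

text \<open>The symbol forces every coefficient at a nonzero frequency to vanish, and subtracting
  the mean removes the remaining one.\<close>

lemma d_zbar_zero_imp_const:
  assumes a: "tsmooth a" "\<And>z. d_zbar a z = 0"
  shows "a z = mean a"
proof -
  have "a z - mean a = 0"
  proof (rule fourier_coeff_zero_imp_zero[where f = "\<lambda>z. a z - mean a"])
    show "tsmooth (\<lambda>z. a z - mean a)" by (intro tsmooth_diff tsmooth_const a)
    fix \<xi> assume \<xi>: "\<xi> \<in> freqs"
    have "fourier_coeff (\<lambda>z. a z - mean a) \<xi> = fourier_coeff a \<xi> - mean a * mean (chi (- \<xi>))"
      by (simp add: fourier_coeff_diff tsmoothD(2) a) (simp add: fourier_coeff_def mean_cmult)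
    moreover have "\<xi> * fourier_coeff a \<xi> = 0"
    proof -
      have "d_zbar a = (\<lambda>z. 0)" using a(2) by auto
      then have "fourier_coeff (d_zbar a) \<xi> = 0" by (simp add: fourier_coeff_def mean_const)
      then show ?thesis using fourier_coeff_d_zbar[OF a(1) \<xi>] by simp
    qed
    ultimately show "fourier_coeff (\<lambda>z. a z - mean a) \<xi> = 0"
      by (auto simp: mean_chi freqs_uminus \<xi> fourier_coeff_0)
  qed
  then show ?thesis by simp
qed


subsection \<open>The three steps\<close>

lemma mean_d_zbar: "tsmooth f \<Longrightarrow> mean (d_zbar f) = 0"
  and mean_d_z: "tsmooth f \<Longrightarrow> mean (d_z f) = 0"
  unfolding d_zbar_eq d_z_eq mean_cmult
  by (simp_all add: mean_add mean_diff mean_cmult mean_ddir tsmoothD(2) tsmooth_ddir tsmooth_cmult)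

lemma d_zbar_mult:
  "tsmooth f \<Longrightarrow> tsmooth h \<Longrightarrow> d_zbar (\<lambda>z. f z * h z) z = f z * d_zbar h z + d_zbar f z * h z"
  by (simp add: d_zbar_smooth ddir_mult tsmoothD smooth_mult field_simps)

lemma d_z_mult:
  "tsmooth f \<Longrightarrow> tsmooth h \<Longrightarrow> d_z (\<lambda>z. f z * h z) z = f z * d_z h z + d_z f z * h z"
  by (simp add: d_z_smooth ddir_mult tsmoothD smooth_mult field_simps)

lemma d_zbar_add:
  "tsmooth f \<Longrightarrow> tsmooth h \<Longrightarrow> d_zbar (\<lambda>z. f z + h z) z = d_zbar f z + d_zbar h z"
  by (simp add: d_zbar_smooth ddir_add tsmoothD smooth_add field_simps)

lemma d_z_add:
  "tsmooth f \<Longrightarrow> tsmooth h \<Longrightarrow> d_z (\<lambda>z. f z + h z) z = d_z f z + d_z h z"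
  by (simp add: d_z_smooth ddir_add tsmoothD smooth_add field_simps)

lemma d_zbar_const: "d_zbar (\<lambda>z. c) z = 0" and d_z_const: "d_z (\<lambda>z. c) z = 0"
  by (simp_all add: d_zbar_smooth d_z_smooth smooth_const)

lemma d_zbar_cmult: "tsmooth f \<Longrightarrow> d_zbar (\<lambda>z. c * f z) z = c * d_zbar f z"
  and d_z_cmult: "tsmooth f \<Longrightarrow> d_z (\<lambda>z. c * f z) z = c * d_z f z"
  by (simp_all add: d_zbar_mult d_z_mult tsmooth_const d_zbar_const d_z_const)

lemma mean_by_parts_d_zbar:
  assumes "tsmooth f" "tsmooth h"
  shows "mean (\<lambda>z. f z * d_zbar h z) = - mean (\<lambda>z. d_zbar f z * h z)"
proof -
  have "0 = mean (d_zbar (\<lambda>z. f z * h z))" by (simp add: mean_d_zbar tsmooth_mult assms)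
  also have "d_zbar (\<lambda>z. f z * h z) = (\<lambda>z. f z * d_zbar h z + d_zbar f z * h z)"
    by (simp add: fun_eq_iff d_zbar_mult assms)
  also have "mean \<dots> = mean (\<lambda>z. f z * d_zbar h z) + mean (\<lambda>z. d_zbar f z * h z)"
    by (intro mean_add tsmoothD(2) tsmooth_mult tsmooth_d_zbar assms)
  finally show ?thesis by (simp add: eq_neg_iff_add_eq_0)
qed

lemma mean_by_parts_d_z:
  assumes "tsmooth f" "tsmooth h"
  shows "mean (\<lambda>z. f z * d_z h z) = - mean (\<lambda>z. d_z f z * h z)"
proof -
  have "0 = mean (d_z (\<lambda>z. f z * h z))" by (simp add: mean_d_z tsmooth_mult assms)
  also have "d_z (\<lambda>z. f z * h z) = (\<lambda>z. f z * d_z h z + d_z f z * h z)"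
    by (simp add: fun_eq_iff d_z_mult assms)
  also have "mean \<dots> = mean (\<lambda>z. f z * d_z h z) + mean (\<lambda>z. d_z f z * h z)"
    by (intro mean_add tsmoothD(2) tsmooth_mult tsmooth_d_z assms)
  finally show ?thesis by (simp add: eq_neg_iff_add_eq_0)
qed

lemma d_zbar_eq_imp_diff_const:
  assumes "tsmooth u" "tsmooth v" "\<And>z. d_zbar u z = d_zbar v z"
  shows "\<exists>C. v = (\<lambda>z. u z + C)"
proof -
  define a where "a z = v z + (-1) * u z" for z
  have a: "tsmooth a" unfolding a_def[abs_def] by (intro tsmooth_add tsmooth_cmult assms)
  have "d_zbar a z = 0" for z
    unfolding a_def[abs_def]
    by (simp only: d_zbar_add d_zbar_cmult tsmooth_cmult assms) simp
  then have "a z = mean a" for z by (rule d_zbar_zero_imp_const[OF a])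
  then have "v = (\<lambda>z. u z + mean a)" by (simp add: a_def fun_eq_iff algebra_simps)
  then show ?thesis by blast
qed

text \<open>The unknown enters the equation only through its \<open>d_zbar\<close>, whose kernel
  consists of the constants.\<close>

lemma determined_step_solution: "determined_up_to_constant (step_solution lat E g m b)"
  unfolding determined_up_to_constant_def
proof (intro allI impI iffI)
  fix u v assume u: "step_solution lat E g m b u"
  { assume v: "step_solution lat E g m b v"
    have "d_zbar u z = d_zbar v z" for z
      using u v unfolding step_solution_def by (metis add_right_imp_eq)
    then show "\<exists>C. v = (\<lambda>z. u z + C)"
      using u v by (intro d_zbar_eq_imp_diff_const) (auto simp: step_solution_def) }
  { assume "\<exists>C. v = (\<lambda>z. u z + C)"
    then show "step_solution lat E g m b v"
      using u by (auto simp: step_solution_def tsmooth_add tsmooth_const d_zbar_add d_zbar_const) }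
qed

lemma top_solution_iff_const: "top_solution lat a \<longleftrightarrow> (\<exists>c. a = (\<lambda>z. c))"
proof
  assume "top_solution lat a"
  then have "a = (\<lambda>z. mean a)"
    unfolding top_solution_def using d_zbar_zero_imp_const by blast
  then show "\<exists>c. a = (\<lambda>z. c)" by blast
qed (auto simp: top_solution_def tsmooth_const d_zbar_const)

section \<open>Solvability of the steps for a fixed metric\<close>

context
  fixes g :: "complex \<Rightarrow> real" and E :: real and G :: "complex \<Rightarrow> complex"
  assumes g: "torus_smooth lat g"
  defines "G \<equiv> \<lambda>z. of_real (g z)"
begin

lemma tsmooth_metric: "tsmooth G"
  using g by (simp add: G_def torus_smooth_def smooth_of_real)

lemma step_solution_iff:
  "step_solution lat E g m b a \<longleftrightarrow> tsmooth a \<and>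
     (\<forall>z. d_zbar a z = - (of_real (E / 2) * (of_nat (2 * m + 1) * (b z * d_z G z) + G z * d_z b z)))"
  unfolding step_solution_def G_def by (simp only: eq_neg_iff_add_eq_0 mult.assoc)

text \<open>Integration by parts turns the mean of \<open>G * d_z b\<close> into minus that of
  \<open>b * d_z G\<close>, so the whole right-hand side has mean zero.\<close>

lemma step_solvable:
  assumes b: "tsmooth b" and m: "mean (\<lambda>z. b z * d_z G z) = 0"
  shows "\<exists>a. step_solution lat E g m b a"
proof -
  define F where "F z = (- of_real (E / 2)) * (of_nat (2 * m + 1) * (b z * d_z G z) + G z * d_z b z)" for z
  note t = tsmooth_mult tsmooth_add tsmooth_cmult tsmooth_const tsmooth_d_z b tsmooth_metric
  have "mean (\<lambda>z. G z * d_z b z) = - mean (\<lambda>z. b z * d_z G z)"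
    using mean_by_parts_d_z[OF tsmooth_metric b] by (simp add: mult.commute)
  then have "mean F = 0"
    unfolding F_def mean_cmult
    by (subst mean_add) (simp_all only: mean_cmult m t tsmoothD(2), simp)
  moreover have "tsmooth F" unfolding F_def[abs_def] by (intro t)
  ultimately obtain a where "tsmooth a" "d_zbar a = F" using d_zbar_solvable by blast
  then have "step_solution lat E g m b a" by (simp add: step_solution_iff F_def)
  then show ?thesis by (rule exI[of "step_solution lat E g m b"])
qed

lemma first_step_solvable: "\<exists>a. step_solution lat E g m (\<lambda>z. c) a"
  by (intro step_solvable tsmooth_const) (simp add: mean_cmult mean_d_z tsmooth_metric)

text \<open>The potential \<open>h\<close> turns factors \<open>d_z G\<close> into
  \<open>d_zbar h\<close>, so that the solvability conditions become statements about
  \<open>d_zbar\<close> alone.\<close>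

lemma metric_potential:
  obtains h where "tsmooth h" "d_zbar h = d_z G"
  using d_zbar_solvable[OF tsmooth_d_z[OF tsmooth_metric] mean_d_z[OF tsmooth_metric]] by blast

text \<open>For constant \<open>c\<close> the term with \<open>d_z c\<close> drops out and the
  right-hand side is a constant multiple of \<open>d_z G\<close>; \<open>\<alpha>\<close> is that
  multiple.\<close>

lemma first_step_form:
  assumes h: "tsmooth h" "d_zbar h = d_z G" and a: "step_solution lat E g m (\<lambda>z. c) a"
  obtains \<alpha> C where "a = (\<lambda>z. \<alpha> * h z + C)"
proof -
  define \<alpha> where "\<alpha> = - (of_real (E / 2) * (of_nat (2 * m + 1) * c))"
  have "d_zbar (\<lambda>z. \<alpha> * h z) z = d_zbar a z" for z
    using a by (simp only: step_solution_iff d_zbar_cmult[OF h(1)] h(2) d_z_const) (simp add: \<alpha>_def)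
  then have "\<exists>C. a = (\<lambda>z. \<alpha> * h z + C)"
    using a by (intro d_zbar_eq_imp_diff_const tsmooth_cmult h) (simp add: step_solution_def)
  then show ?thesis using that by blast
qed

text \<open>The integrands are the \<open>d_zbar\<close> derivatives of \<open>h^2 / 2\<close> and
  \<open>h^3 / 3\<close>; integration by parts equates each mean with minus itself or minus twice
  itself.\<close>

lemma mean_power_d_zbar:
  assumes "tsmooth h"
  shows "mean (\<lambda>z. h z * d_zbar h z) = 0" "mean (\<lambda>z. h z * (h z * d_zbar h z)) = 0"
proof -
  note t = tsmooth_mult tsmooth_d_zbar assms
  have "mean (\<lambda>z. h z * d_zbar h z) = - mean (\<lambda>z. h z * d_zbar h z)"
    using mean_by_parts_d_zbar[OF assms assms] by (simp add: mult.commute)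
  then show "mean (\<lambda>z. h z * d_zbar h z) = 0" by (simp add: eq_neg_iff_add_eq_0)
  have "mean (\<lambda>z. h z * (h z * d_zbar h z)) = mean (\<lambda>z. (h z * h z) * d_zbar h z)"
    by (simp add: mult.assoc)
  also have "\<dots> = - mean (\<lambda>z. d_zbar (\<lambda>z. h z * h z) z * h z)"
    by (intro mean_by_parts_d_zbar t)
  also have "(\<lambda>z. d_zbar (\<lambda>z. h z * h z) z * h z) = (\<lambda>z. 2 * (h z * (h z * d_zbar h z)))"
    by (simp add: d_zbar_mult assms fun_eq_iff algebra_simps)
  finally show "mean (\<lambda>z. h z * (h z * d_zbar h z)) = 0"
    by (simp add: mean_cmult eq_neg_iff_add_eq_0)
qed

lemma second_step_solvable:
  assumes a: "step_solution lat E g m (\<lambda>z. c) a"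
  shows "\<exists>a'. step_solution lat E g m' a a'"
proof (rule step_solvable)
  show "tsmooth a" using a by (simp add: step_solution_def)
  obtain h where h: "tsmooth h" "d_zbar h = d_z G" by (rule metric_potential)
  obtain \<alpha> C where a_eq: "a = (\<lambda>z. \<alpha> * h z + C)" by (rule first_step_form[OF h a])
  have "mean (\<lambda>z. a z * d_z G z) = mean (\<lambda>z. \<alpha> * (h z * d_zbar h z) + C * d_zbar h z)"
    by (simp add: a_eq h(2) algebra_simps)
  also have "\<dots> = \<alpha> * mean (\<lambda>z. h z * d_zbar h z) + C * mean (d_zbar h)"
    by (subst mean_add; (intro tsmoothD(2) tsmooth_cmult tsmooth_mult tsmooth_d_zbar h)?)
      (simp only: mean_cmult)
  finally show "mean (\<lambda>z. a z * d_z G z) = 0"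
    by (simp add: mean_power_d_zbar mean_d_zbar h(1))
qed

text \<open>No formula for \<open>a'\<close> is available; moving \<open>d_zbar\<close> from
  \<open>h\<close> to \<open>a'\<close> brings in the equation of \<open>a'\<close>, which involves
  only the explicit \<open>a\<close> and \<open>G\<close>.\<close>

lemma third_step_solvable:
  assumes a: "step_solution lat E g m (\<lambda>z. c) a" and a': "step_solution lat E g m' a a'"
  shows "\<exists>a''. step_solution lat E g m'' a' a''"
proof (rule step_solvable)
  show ta': "tsmooth a'" using a' by (simp add: step_solution_def)
  obtain h where h: "tsmooth h" "d_zbar h = d_z G" by (rule metric_potential)
  obtain \<alpha> C where a_eq: "a = (\<lambda>z. \<alpha> * h z + C)" by (rule first_step_form[OF h a])
  note t = tsmooth_cmult tsmooth_add tsmooth_mult tsmooth_d_zbar tsmooth_d_z h(1) tsmooth_metric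
  define e k :: complex where "e = - of_real (E / 2)" and "k = of_nat (2 * m' + 1)"
  have lin: "mean (\<lambda>z. e * (k * (\<alpha> * P z + C * Q z) + \<alpha> / 2 * R z))
      = e * (k * (\<alpha> * mean P + C * mean Q) + \<alpha> / 2 * mean R)"
    if "continuous_on UNIV P" "continuous_on UNIV Q" "continuous_on UNIV R" for P Q R
    using that by (simp only: mean_cmult mean_add continuous_intros)
  have hh: "d_zbar (\<lambda>z. h z * h z) z = 2 * (h z * d_zbar h z)"
    "d_z (\<lambda>z. h z * h z) z = 2 * (h z * d_z h z)" for z
    by (simp_all add: d_zbar_mult d_z_mult h(1))
  have da: "d_z a z = \<alpha> * d_z h z" for z
    by (simp add: a_eq d_z_add d_z_cmult d_z_const tsmooth_const t)
  have "d_zbar a' z = e * (k * (a z * d_z G z) + G z * d_z a z)" for z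
    using a' by (simp add: step_solution_iff e_def k_def)
  moreover have "a z = \<alpha> * h z + C" for z by (simp add: a_eq)
  \<comment> \<open>Since \<open>d_z a = \<alpha> * d_z h\<close>, the product
    \<open>h * d_z a\<close> equals \<open>\<alpha> / 2\<close> times \<open>d_z (h * h)\<close>,
    which leaves a single \<open>d_z\<close> to integrate by parts.\<close>
  ultimately have "d_zbar a' z * h z
    = e * (k * (\<alpha> * (h z * (h z * d_zbar h z)) + C * (h z * d_zbar h z))
      + \<alpha> / 2 * (G z * d_z (\<lambda>z. h z * h z) z))" for z
    by (simp add: da hh h(2)[symmetric] algebra_simps)
  then have "mean (\<lambda>z. d_zbar a' z * h z)
    = mean (\<lambda>z. e * (k * (\<alpha> * (h z * (h z * d_zbar h z)) + C * (h z * d_zbar h z))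
      + \<alpha> / 2 * (G z * d_z (\<lambda>z. h z * h z) z)))"
    by simp
  also have "\<dots> = e * (k * (\<alpha> * mean (\<lambda>z. h z * (h z * d_zbar h z)) + C * mean (\<lambda>z. h z * d_zbar h z))
      + \<alpha> / 2 * mean (\<lambda>z. G z * d_z (\<lambda>z. h z * h z) z))"
    by (intro lin tsmoothD(2) t)
  \<comment> \<open>Moving \<open>d_z\<close> onto \<open>G\<close> and using
    \<open>d_z G = d_zbar h\<close> gives once more the mean of
    \<open>h * h * d_zbar h\<close>.\<close>
  also have "mean (\<lambda>z. G z * d_z (\<lambda>z. h z * h z) z) = - mean (\<lambda>z. d_z G z * (h z * h z))"
    by (intro mean_by_parts_d_z t)
  also have "(\<lambda>z. d_z G z * (h z * h z)) = (\<lambda>z. h z * (h z * d_zbar h z))"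
    by (simp add: h(2) fun_eq_iff mult_ac)
  finally have "mean (\<lambda>z. d_zbar a' z * h z) = 0"
    by (simp add: mean_power_d_zbar h(1))
  \<comment> \<open>A last integration by parts passes back to \<open>a' * d_zbar h\<close>, which
    is \<open>a' * d_z G\<close>.\<close>
  then show "mean (\<lambda>z. a' z * d_z G z) = 0"
    using mean_by_parts_d_zbar[OF ta' h(1)] by (simp add: h(2))
qed

end

end

section \<open>Plane lattices as instances of the torus locale, and the theorem\<close>

lemma plane_lattice_torus:
  assumes "plane_lattice \<Gamma>"
  obtains w1 w2 where "torus w1 w2" "\<Gamma> = torus.lat w1 w2"
proof -
  obtain w1 w2 where w: "w1 \<noteq> w2" "independent {w1, w2}"
      and \<Gamma>: "\<Gamma> = {of_int m * w1 + of_int n * w2 | (m::int) (n::int). True}"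
    using assms unfolding plane_lattice_def by blast
  have "torus w1 w2"
  proof
    show "Im (cnj w1 * w2) \<noteq> 0"
    proof
      assume 0: "Im (cnj w1 * w2) = 0"
      have nz: "w1 \<noteq> 0" using w(2) dependent_zero[of "{w1, w2}"] by auto
      \<comment> \<open>With zero determinant \<open>cnj w1 * w2\<close> is real, so multiplying it
        by \<open>w1\<close> exhibits \<open>w2\<close> as a real multiple of \<open>w1\<close>,
        against independence.\<close>
      have "of_real ((norm w1)\<^sup>2) * w2 = w1 * (cnj w1 * w2)"
        by (simp only: complex_norm_square mult_ac)
      also have "cnj w1 * w2 = of_real (Re (cnj w1 * w2))" using 0 by (simp add: complex_eq_iff)
      finally have "w2 = (Re (cnj w1 * w2) / (norm w1)\<^sup>2) *\<^sub>R w1"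
        using nz by (simp add: scaleR_conv_of_real field_simps)
      then have "w2 \<in> span {w1}" by (metis span_base span_scale singletonI)
      moreover have "w2 \<notin> span {w1}"
        using w by (metis independent_insert insert_commute singletonD)
      ultimately show False by contradiction
    qed
  qed
  then show ?thesis using that \<Gamma> torus.lat_def by metis
qed

theorem theorem1:
  fixes \<Gamma> :: "complex set" and g :: "complex \<Rightarrow> real" and E :: real and q :: nat
  assumes "plane_lattice \<Gamma>"
    and "torus_smooth \<Gamma> g" and "\<And>z. g z > 0"
    and "E > 0"
  shows
    "(\<forall>a. top_solution \<Gamma> a \<longleftrightarrow> (\<exists>c. a = (\<lambda>z. c))) \<and>
     (\<forall>c::complex. c \<noteq> 0 \<longrightarrow>
       (q \<ge> 1 \<longrightarrow>
          (\<exists>a1. step_solution \<Gamma> E g q (\<lambda>z. c) a1) \<and>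
          determined_up_to_constant (step_solution \<Gamma> E g q (\<lambda>z. c))) \<and>
       (q \<ge> 2 \<longrightarrow>
          (\<forall>a1. step_solution \<Gamma> E g q (\<lambda>z. c) a1 \<longrightarrow>
             (\<exists>a2. step_solution \<Gamma> E g (q - 1) a1 a2) \<and>
             determined_up_to_constant (step_solution \<Gamma> E g (q - 1) a1))) \<and>
       (q \<ge> 3 \<longrightarrow>
          (\<forall>a1 a2. step_solution \<Gamma> E g q (\<lambda>z. c) a1 \<longrightarrow>
             step_solution \<Gamma> E g (q - 1) a1 a2 \<longrightarrow>
             (\<exists>a3. step_solution \<Gamma> E g (q - 2) a2 a3) \<and>
             determined_up_to_constant (step_solution \<Gamma> E g (q - 2) a2))))"
proof -
  obtain w1 w2 where t: "torus w1 w2" and \<Gamma>: "\<Gamma> = torus.lat w1 w2"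
    using plane_lattice_torus[OF assms(1)] by blast
  interpret torus w1 w2 by (rule t)
  have g: "torus_smooth lat g" using assms(2) by (simp add: \<Gamma>)
  \<comment> \<open>The three step lemmas hold for arbitrary indices; here these are
    \<open>q\<close>, \<open>q - 1\<close> and \<open>q - 2\<close>.\<close>
  show ?thesis
    unfolding \<Gamma>
    by (intro conjI allI impI top_solution_iff_const determined_step_solution
          first_step_solvable[OF g])
      (erule second_step_solvable[OF g] third_step_solvable[OF g]; assumption?)+
qed

end
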